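(* Let $\mathcal{H}_A$ and $\mathcal{H}_B$ be finite-dimensional complex Hilbert spaces and let $\mathcal{S}$ be a complete orthogonal product basis of $\mathcal{H}_A \otimes \mathcal{H}_B$ which is distinguishable by LOCC between the two parties $A$ and $B$. Then $\mathcal{S}$ cannot be made locally indistinguishable via any (orthogonality-preserving) LPCC protocol. In other words, $\mathcal{S}$ is not activable under LPCC.
   Context: A complete orthogonal product basis of $\mathcal{H}_A\otimes\mathcal{H}_B$ is an orthonormal basis of $\mathcal{H}_A\otimes\mathcal{H}_B$ all of whose elements are product vectors $|a_i\rangle\otimes|b_i\rangle$. A finite set of pairwise orthogonal states shared between spatially separated parties (one tensor factor per party) is locally distinguishable (distinguishable by LOCC) if, when one state is secretly chosen from the known set, the parties can identify it perfectly using only local quantum operations (local measurements) and classical communication (LOCC); otherwise it is locally indistinguishable. A local projective measurement by party $A$ is a family $\{P_k\}$ of orthogonal projectors on $\mathcal{H}_A$ with $P_kP_l=0$ for $k\neq l$ and $\sum_k P_k=\mathbb{I}$; outcome $k$ sends a state $|\psi\rangle$ to the (unnormalized) post-measurement state $(P_k\otimes\mathbb{I})|\psi\rangle$. Measurements by party $B$ are defined analogously. Such a measurement is orthogonality-preserving for a set of pairwise orthogonal states if, for every outcome $k$, the post-measurement states of the set are pairwise orthogonal; this is called an orthogonality-preserving local projective measurement (OPLPM). An (orthogonality-preserving) LPCC protocol (local projective measurements with classical communication) is a finite sequence of steps; at each step one party, chosen possibly depending on the previous outcomes, performs a local projective measurement (also possibly depending on previous outcomes) that is orthogonality-preserving for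 the current set of states, and the outcome is communicated to the other party. The current set is then replaced by the set of nonzero post-measurement states for that outcome (normalized). A locally distinguishable set is activable under LPCC if there is an orthogonality-preserving LPCC protocol and a sequence of outcomes after which the set of remaining nonzero post-measurement states is locally indistinguishable (by LOCC). *)

theory Defs
  imports "Jordan_Normal_Form.Schur_Decomposition"
begin

datatype party = Alice | Bob

text \<open>
  The local spaces are \<open>\<complex>\<^sup>n\<close> with \<open>n = D Alice\<close> and \<open>n = D Bob\<close> for a function
  \<open>D :: party \<Rightarrow> nat\<close>. The basis vector \<open>e\<^sub>i \<otimes> e\<^sub>j\<close> of the tensor product has index
  \<open>i * D Bob + j\<close>.
\<close>

abbreviation joint_dim :: "(party \<Rightarrow> nat) \<Rightarrow> nat" where
  "joint_dim D \<equiv> D Alice * D Bob"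

definition tensor_vec :: "complex vec \<Rightarrow> complex vec \<Rightarrow> complex vec" where
  "tensor_vec u v = vec (dim_vec u * dim_vec v)
     (\<lambda>i. u $ (i div dim_vec v) * v $ (i mod dim_vec v))"

definition tensor_mat :: "complex mat \<Rightarrow> complex mat \<Rightarrow> complex mat" where
  "tensor_mat A B = mat (dim_row A * dim_row B) (dim_col A * dim_col B)
     (\<lambda>(i, j). A $$ (i div dim_row B, j div dim_col B) * B $$ (i mod dim_row B, j mod dim_col B))"

fun local_op :: "(party \<Rightarrow> nat) \<Rightarrow> party \<Rightarrow> complex mat \<Rightarrow> complex mat" where
  "local_op D Alice K = tensor_mat K (1\<^sub>m (D Bob))"
| "local_op D Bob K = tensor_mat (1\<^sub>m (D Alice)) K"

definition sum_mats :: "nat \<Rightarrow> complex mat list \<Rightarrow> complex mat" where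
  "sum_mats n Ms = foldr (+) Ms (0\<^sub>m n n)"

definition mat_trace :: "complex mat \<Rightarrow> complex" where
  "mat_trace A = (\<Sum>i<dim_row A. A $$ (i, i))"

definition pure_density :: "complex vec \<Rightarrow> complex mat" where
  "pure_density \<psi> = mat (dim_vec \<psi>) (dim_vec \<psi>) (\<lambda>(i, j). \<psi> $ i * cnj (\<psi> $ j))"

definition normalized :: "complex vec \<Rightarrow> complex vec" where
  "normalized \<psi> = complex_of_real (1 / sqrt (Re (\<psi> \<bullet>c \<psi>))) \<cdot>\<^sub>v \<psi>"

definition complete_orthogonal_product_basis :: "(party \<Rightarrow> nat) \<Rightarrow> complex vec set \<Rightarrow> bool" where
  "complete_orthogonal_product_basis D S \<longleftrightarrow>
     vectorspace.basis class_ring (module_vec TYPE(complex) (joint_dim D)) S \<and>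
     (\<forall>\<psi>\<in>S. \<forall>\<phi>\<in>S. \<psi> \<bullet>c \<phi> = (if \<psi> = \<phi> then 1 else 0)) \<and>
     (\<forall>\<psi>\<in>S. \<exists>a\<in>carrier_vec (D Alice). \<exists>b\<in>carrier_vec (D Bob). \<psi> = tensor_vec a b)"

text \<open>
  A protocol with a finite number of rounds, as a tree. In each round one party applies a quantum
  instrument with finitely many outcomes and announces the outcome, on which everything that
  follows may depend. A branch \<open>(d, Ks, Q)\<close> stands for one outcome: the completely positive map
  with Kraus operators \<open>Ks\<close>, whose output space is \<open>\<complex>\<^sup>d\<close> (so the party may attach or discard
  ancillas), followed by the protocol \<open>Q\<close>. At a leaf the parties announce their answer.
\<close>

datatype 'l locc =
    Answer 'l
  | Round party "(nat \<times> complex mat list \<times> 'l locc) list"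

definition instrument :: "nat \<Rightarrow> (nat \<times> complex mat list) list \<Rightarrow> bool" where
  "instrument n ops \<longleftrightarrow>
     (\<forall>(d, Ks)\<in>set ops. set Ks \<subseteq> carrier_mat d n) \<and>
     sum_mats n (map (\<lambda>K. mat_adjoint K * K) (concat (map snd ops))) = 1\<^sub>m n"

fun valid_locc :: "(party \<Rightarrow> nat) \<Rightarrow> 'l locc \<Rightarrow> bool" where
  "valid_locc D (Answer l) \<longleftrightarrow> True"
| "valid_locc D (Round p bs) \<longleftrightarrow>
     instrument (D p) (map (\<lambda>(d, Ks, Q). (d, Ks)) bs) \<and>
     (\<forall>(d, Ks, Q)\<in>set bs. valid_locc (D(p := d)) Q)"

definition apply_kraus ::
  "(party \<Rightarrow> nat) \<Rightarrow> party \<Rightarrow> nat \<Rightarrow> complex mat list \<Rightarrow> complex mat \<Rightarrow> complex mat" where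
  "apply_kraus D p d Ks \<rho> = sum_mats (joint_dim (D(p := d)))
     (map (\<lambda>K. local_op D p K * \<rho> * mat_adjoint (local_op D p K)) Ks)"

text \<open>
  The probability of the answer \<open>l\<close> on the state \<open>\<rho>\<close>. Density operators are left unnormalized
  along a branch, so the trace at a leaf is the probability of reaching it.
\<close>

fun answer_prob :: "(party \<Rightarrow> nat) \<Rightarrow> 'l locc \<Rightarrow> complex mat \<Rightarrow> 'l \<Rightarrow> complex" where
  "answer_prob D (Answer l') \<rho> l = (if l' = l then mat_trace \<rho> else 0)"
| "answer_prob D (Round p bs) \<rho> l =
     (\<Sum>(d, Ks, Q)\<leftarrow>bs. answer_prob (D(p := d)) Q (apply_kraus D p d Ks \<rho>) l)"

definition locc_distinguishable :: "(party \<Rightarrow> nat) \<Rightarrow> complex vec set \<Rightarrow> bool" where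
  "locc_distinguishable D S \<longleftrightarrow>
     (\<exists>Q :: complex vec locc. valid_locc D Q \<and>
        (\<forall>\<psi>\<in>S. answer_prob D Q (pure_density \<psi>) \<psi> = 1))"

definition projector :: "nat \<Rightarrow> complex mat \<Rightarrow> bool" where
  "projector n P \<longleftrightarrow> P \<in> carrier_mat n n \<and> mat_adjoint P = P \<and> P * P = P"

definition projective_measurement :: "nat \<Rightarrow> complex mat list \<Rightarrow> bool" where
  "projective_measurement n Ps \<longleftrightarrow>
     (\<forall>P\<in>set Ps. projector n P) \<and>
     (\<forall>k<length Ps. \<forall>l<length Ps. k \<noteq> l \<longrightarrow> Ps ! k * Ps ! l = 0\<^sub>m n n) \<and>
     sum_mats n Ps = 1\<^sub>m n"

text \<open>
  Orthogonality is required of the images of distinct members of \<open>S\<close>, not of distinct members of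
  the image of \<open>S\<close>: two states with the same nonzero image are not orthogonal afterwards.
\<close>

definition OPLPM :: "(party \<Rightarrow> nat) \<Rightarrow> complex vec set \<Rightarrow> party \<Rightarrow> complex mat list \<Rightarrow> bool" where
  "OPLPM D S p Ps \<longleftrightarrow>
     projective_measurement (D p) Ps \<and>
     (\<forall>P\<in>set Ps. \<forall>\<psi>\<in>S. \<forall>\<phi>\<in>S. \<psi> \<noteq> \<phi> \<longrightarrow>
        (local_op D p P *\<^sub>v \<psi>) \<bullet>c (local_op D p P *\<^sub>v \<phi>) = 0)"

definition post_states ::
  "(party \<Rightarrow> nat) \<Rightarrow> party \<Rightarrow> complex mat \<Rightarrow> complex vec set \<Rightarrow> complex vec set" where
  "post_states D p P S =
     {normalized (local_op D p P *\<^sub>v \<psi>) | \<psi>.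
        \<psi> \<in> S \<and> local_op D p P *\<^sub>v \<psi> \<noteq> 0\<^sub>v (joint_dim D)}"

text \<open>
  A protocol tree: \<open>Measure p bs\<close> is a measurement by \<open>p\<close>, each outcome being given by its
  projector together with the protocol that follows it.
\<close>

datatype lpcc = Stop | Measure party "(complex mat \<times> lpcc) list"

fun op_lpcc :: "(party \<Rightarrow> nat) \<Rightarrow> complex vec set \<Rightarrow> lpcc \<Rightarrow> bool" where
  "op_lpcc D S Stop \<longleftrightarrow> True"
| "op_lpcc D S (Measure p bs) \<longleftrightarrow>
     OPLPM D S p (map fst bs) \<and>
     (\<forall>(P, Q)\<in>set bs. op_lpcc D (post_states D p P S) Q)"

text \<open>
  \<open>remaining D S Q ks S'\<close>: the first \<open>length ks\<close> steps of \<open>Q\<close>, started on \<open>S\<close>, can have the outcomes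
  \<open>ks\<close>, and \<open>S'\<close> is the set of states after them.
\<close>

inductive remaining ::
  "(party \<Rightarrow> nat) \<Rightarrow> complex vec set \<Rightarrow> lpcc \<Rightarrow> nat list \<Rightarrow> complex vec set \<Rightarrow> bool"
  for D where
  "remaining D S Q [] S"
| "k < length bs \<Longrightarrow> bs ! k = (P, Q) \<Longrightarrow> remaining D (post_states D p P S) Q ks S' \<Longrightarrow>
     remaining D S (Measure p bs) (k # ks) S'"

definition activable_lpcc :: "(party \<Rightarrow> nat) \<Rightarrow> complex vec set \<Rightarrow> bool" where
  "activable_lpcc D S \<longleftrightarrow>
     (\<exists>Q ks S'. op_lpcc D S Q \<and> remaining D S Q ks S' \<and> \<not> locc_distinguishable D S')"

end

theory Submission
  imports Defs
    "Jordan_Normal_Form.Jordan_Normal_Form_Existence"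
    "Jordan_Normal_Form.Jordan_Normal_Form_Uniqueness"
begin

text \<open>
  After any sequence of outcomes the remaining states are the normalized nonzero images of \<open>S\<close>
  under \<open>M = A \<otimes> B\<close>, where \<open>A\<close> and \<open>B\<close> are products of the projectors of the two parties, and the
  images of distinct states are orthogonal. So \<open>\<langle>\<psi>, M\<^sup>* M \<phi>\<rangle> = 0\<close> for distinct \<open>\<psi>, \<phi> \<in> S\<close>, and as
  \<open>S\<close> is an orthonormal basis, each \<open>\<psi> \<in> S\<close> is an eigenvector of \<open>M\<^sup>* M\<close>, with eigenvalue
  \<open>\<parallel>M \<psi>\<parallel>\<^sup>2\<close>. Polar decomposition gives partial isometries \<open>U\<close> and \<open>V\<close> with \<open>U\<^sup>* A = \<bar>A\<bar>\<close> and
  \<open>V\<^sup>* B = \<bar>B\<bar>\<close>, so \<open>(U\<^sup>* \<otimes> V\<^sup>*) M \<psi> = \<bar>M\<bar> \<psi> = \<parallel>M \<psi>\<parallel> \<psi>\<close>. Hence local operations turn each remaining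
  state back into the member of \<open>S\<close> it came from, and the given protocol for \<open>S\<close> then identifies it.
\<close>

section \<open>Adjoints and Hermitian matrices\<close>

lemma mult_carrier_square [simp]:
  "A \<in> carrier_mat n n \<Longrightarrow> B \<in> carrier_mat n n \<Longrightarrow> A * B \<in> carrier_mat n n"
  by (rule mult_carrier_mat)

lemma adjoint_dim [simp]:
  "dim_row (mat_adjoint A) = dim_col A" "dim_col (mat_adjoint A) = dim_row A"
  by (auto simp: mat_adjoint_def)

lemma adjoint_carrier [simp, intro]: "A \<in> carrier_mat m n \<Longrightarrow> mat_adjoint A \<in> carrier_mat n m"
  by (intro carrier_matI) auto

lemma adjoint_index [simp]:
  fixes A :: "complex mat"
  assumes "i < dim_col A" "j < dim_row A"
  shows "mat_adjoint A $$ (i, j) = cnj (A $$ (j, i))"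
  using assms by (simp add: mat_adjoint_def mat_of_rows_index)

lemma adjoint_adjoint [simp]: "mat_adjoint (mat_adjoint A) = (A :: complex mat)"
  by (rule eq_matI) auto

lemma adjoint_mult:
  fixes A B :: "complex mat"
  assumes "A \<in> carrier_mat l m" "B \<in> carrier_mat m n"
  shows "mat_adjoint (A * B) = mat_adjoint B * mat_adjoint A"
  using assms by (intro eq_matI) (auto simp: scalar_prod_def mult.commute)

lemma adjoint_minus:
  fixes A B :: "complex mat"
  assumes "A \<in> carrier_mat m n" "B \<in> carrier_mat m n"
  shows "mat_adjoint (A - B) = mat_adjoint A - mat_adjoint B"
  using assms by (intro eq_matI) auto

lemma adjoint_one [simp]: "mat_adjoint (1\<^sub>m n) = (1\<^sub>m n :: complex mat)"
  by (rule eq_matI) auto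

section \<open>The complex inner product of coordinate vectors\<close>

lemma cscalar_prod_eq_sum:
  fixes x y :: "complex vec"
  assumes "y \<in> carrier_vec n"
  shows "x \<bullet>c y = (\<Sum>i<n. x $ i * cnj (y $ i))"
  using assms by (simp add: scalar_prod_def atLeast0LessThan)

lemma cscalar_prod_smult_left:
  fixes x y :: "complex vec"
  assumes "x \<in> carrier_vec n" "y \<in> carrier_vec n"
  shows "(a \<cdot>\<^sub>v x) \<bullet>c y = a * (x \<bullet>c y)"
  using assms by (simp add: cscalar_prod_eq_sum[where n = n] sum_distrib_left mult.assoc)

lemma cscalar_prod_smult_right:
  fixes x y :: "complex vec"
  assumes "x \<in> carrier_vec n" "y \<in> carrier_vec n"
  shows "x \<bullet>c (a \<cdot>\<^sub>v y) = cnj a * (x \<bullet>c y)"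
  using assms by (simp add: cscalar_prod_eq_sum[where n = n] sum_distrib_left algebra_simps)

lemma cscalar_prod_add_left:
  fixes x y z :: "complex vec"
  assumes "x \<in> carrier_vec n" "y \<in> carrier_vec n" "z \<in> carrier_vec n"
  shows "(x + y) \<bullet>c z = x \<bullet>c z + y \<bullet>c z"
  using assms by (simp add: cscalar_prod_eq_sum[where n = n] sum.distrib algebra_simps)

lemma cscalar_prod_minus_left:
  fixes x y z :: "complex vec"
  assumes "x \<in> carrier_vec n" "y \<in> carrier_vec n" "z \<in> carrier_vec n"
  shows "(x - y) \<bullet>c z = x \<bullet>c z - y \<bullet>c z"
  using assms by (simp add: cscalar_prod_eq_sum[where n = n] sum_subtractf algebra_simps)

lemma cscalar_prod_adjoint:
  fixes A :: "complex mat"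
  assumes "A \<in> carrier_mat m n" "x \<in> carrier_vec n" "y \<in> carrier_vec m"
  shows "(A *\<^sub>v x) \<bullet>c y = x \<bullet>c (mat_adjoint A *\<^sub>v y)"
proof -
  have "(A *\<^sub>v x) \<bullet>c y = (\<Sum>i<m. \<Sum>j<n. A $$ (i, j) * x $ j * cnj (y $ i))"
    using assms by (simp add: cscalar_prod_eq_sum[where n = m] scalar_prod_def
        sum_distrib_right atLeast0LessThan)
  also have "\<dots> = (\<Sum>j<n. \<Sum>i<m. A $$ (i, j) * x $ j * cnj (y $ i))"
    by (rule sum.swap)
  also have "\<dots> = x \<bullet>c (mat_adjoint A *\<^sub>v y)"
    using assms by (simp add: cscalar_prod_eq_sum[where n = n] scalar_prod_def
        sum_distrib_left atLeast0LessThan mult_ac)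
  finally show ?thesis .
qed

lemma mult_mat_zero_vec:
  "(L :: complex mat) \<in> carrier_mat m n \<Longrightarrow> L *\<^sub>v 0\<^sub>v n = 0\<^sub>v m"
  by (intro eq_vecI) (auto simp: scalar_prod_def)

lemma cscalar_prod_self:
  fixes x :: "complex vec"
  shows "x \<bullet>c x = complex_of_real (Re (x \<bullet>c x))" "0 \<le> Re (x \<bullet>c x)"
  using conjugate_square_ge_0_vec[of x]
  by (simp_all add: less_eq_complex_def complex_eq_iff)

lemma cscalar_prod_self_eq_0:
  fixes x :: "complex vec"
  assumes "x \<in> carrier_vec n"
  shows "Re (x \<bullet>c x) = 0 \<longleftrightarrow> x = 0\<^sub>v n"
  using conjugate_square_eq_0_vec[OF assms] cscalar_prod_self(1)[of x] by auto

text \<open>The diagonal entries of \<open>mat_adjoint A * A\<close> are the squared norms of the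
  columns of \<open>A\<close>.\<close>

lemma adjoint_mult_self_eq_0:
  fixes A :: "complex mat"
  assumes A: "A \<in> carrier_mat m n" and 0: "mat_adjoint A * A = 0\<^sub>m n n"
  shows "A = 0\<^sub>m m n"
proof (rule eq_matI)
  fix i j assume ij: "i < dim_row (0\<^sub>m m n :: complex mat)" "j < dim_col (0\<^sub>m m n :: complex mat)"
  have "col A j \<bullet>c col A j = (mat_adjoint A * A) $$ (j, j)"
    using A ij by (simp add: scalar_prod_def mult.commute)
  also have "\<dots> = 0" using ij unfolding 0 by simp
  finally have "col A j = 0\<^sub>v m"
    using A ij by (subst (asm) conjugate_square_eq_0_vec[where n = m]) auto
  then have "col A j $ i = 0" using ij by simp
  then show "A $$ (i, j) = 0\<^sub>m m n $$ (i, j)" using A ij by simp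
qed (use A in auto)

section \<open>Diagonalizing Hermitian matrices through the Jordan normal form\<close>

lemma char_matrix_mult_vec:
  assumes "A \<in> carrier_mat n n" "x \<in> carrier_vec n"
  shows "char_matrix A e *\<^sub>v x = A *\<^sub>v x - e \<cdot>\<^sub>v (x :: complex vec)"
  using assms by (intro eq_vecI)
    (auto simp: char_matrix_def add_scalar_prod_distrib[where n = n])

lemma minus_vec_eq_0D:
  fixes u v :: "'a :: group_add vec"
  assumes "u \<in> carrier_vec n" "v \<in> carrier_vec n" "u - v = 0\<^sub>v n"
  shows "u = v"
proof (rule eq_vecI)
  fix i assume i: "i < dim_vec v"
  then have "u $ i - v $ i = (u - v) $ i" using assms(1,2) by simp
  also have "\<dots> = 0" using assms i by simp
  finally show "u $ i = v $ i" by simp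
qed (use assms in auto)

text \<open>Since \<open>y\<close> satisfies the eigenvalue equation, \<open>e\<close> is real
  unless \<open>y\<close> is zero; for real \<open>e\<close>, moving \<open>A\<close> across the
  inner product of \<open>x\<close> and \<open>y\<close> leaves \<open>y \<bullet>c y = 0\<close>.
  So a Hermitian matrix has no Jordan chain of length two.\<close>

lemma hermitian_gen_eigenvector:
  fixes A :: "complex mat"
  assumes A: "A \<in> carrier_mat n n" and herm: "mat_adjoint A = A"
    and x: "x \<in> carrier_vec n" and y: "y \<in> carrier_vec n"
    and Ax: "A *\<^sub>v x = e \<cdot>\<^sub>v x + y" and Ay: "A *\<^sub>v y = e \<cdot>\<^sub>v y"
  shows "y = 0\<^sub>v n"
proof -
  have "(A *\<^sub>v y) \<bullet>c y = y \<bullet>c (A *\<^sub>v y)"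
    using cscalar_prod_adjoint[OF A y y] herm by simp
  then have 1: "e * (y \<bullet>c y) = cnj e * (y \<bullet>c y)"
    using y by (simp add: Ay cscalar_prod_smult_left[where n = n] cscalar_prod_smult_right[where n = n])
  have "(A *\<^sub>v x) \<bullet>c y = x \<bullet>c (A *\<^sub>v y)"
    using cscalar_prod_adjoint[OF A x y] herm by simp
  then have 2: "e * (x \<bullet>c y) + y \<bullet>c y = cnj e * (x \<bullet>c y)"
    using x y by (simp add: Ax Ay cscalar_prod_smult_left[where n = n]
        cscalar_prod_add_left[where n = n] cscalar_prod_smult_right[where n = n])
  from 1 2 have "y \<bullet>c y = 0" by auto
  then show ?thesis using y by simp
qed

lemma diagonal_jordan_matrix:
  assumes "\<And>n a. (n, a) \<in> set n_as \<Longrightarrow> n = 1"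
  shows "diagonal_mat (jordan_matrix n_as)"
  using assms
proof (induction n_as)
  case Nil
  then show ?case by (simp add: diagonal_mat_def)
next
  case (Cons p n_as)
  obtain a where p: "p = (1, a)" using Cons.prems by (cases p) auto
  have "diagonal_mat (jordan_matrix n_as)" using Cons by auto
  then show ?case
    unfolding p jordan_matrix_Cons diagonal_mat_def by (auto simp: jordan_block_def)
qed

text \<open>Over the complex numbers a Jordan form exists, and hermiticity forces its blocks to have
  size 1. The similarity obtained need not be unitary; \<open>functional_calculus\<close> makes up
  for that.\<close>

lemma hermitian_diagonalizable:
  fixes A :: "complex mat"
  assumes A: "A \<in> carrier_mat n n" and herm: "mat_adjoint A = A"
  obtains D where "diagonal_mat D" "similar_mat A D"
proof -
  from char_poly_factorized[OF A] obtain n_as where jnf: "jordan_nf A n_as"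
    using jordan_nf_exists[OF A] by blast
  have "k = 1" if ke: "(k, e) \<in> set n_as" for k e
  proof -
    \<comment> \<open>A Jordan block of size at least two would enlarge the kernel from \<open>?M\<close> to \<open>?M\<^sup>2\<close>.\<close>
    let ?M = "char_matrix A e"
    have M: "?M \<in> carrier_mat n n" using A by simp
    have "mat_kernel (?M ^\<^sub>m 2) = mat_kernel (?M ^\<^sub>m 1)"
    proof -
      have "?M *\<^sub>v x = 0\<^sub>v n" if x: "x \<in> carrier_vec n" and 0: "?M *\<^sub>v (?M *\<^sub>v x) = 0\<^sub>v n" for x
      proof (rule hermitian_gen_eigenvector[OF A herm x])
        show y: "?M *\<^sub>v x \<in> carrier_vec n" using M x by simp
        show "A *\<^sub>v x = e \<cdot>\<^sub>v x + ?M *\<^sub>v x"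
          unfolding char_matrix_mult_vec[OF A x] using A x by (intro eq_vecI) auto
        show "A *\<^sub>v (?M *\<^sub>v x) = e \<cdot>\<^sub>v (?M *\<^sub>v x)"
          by (rule minus_vec_eq_0D[OF _ _ 0[unfolded char_matrix_mult_vec[OF A y]]])
            (use A y in auto)
      qed
      moreover have "?M ^\<^sub>m 2 = ?M * ?M" "?M ^\<^sub>m 1 = ?M"
        using M by (auto simp: numeral_2_eq_2)
      ultimately show ?thesis
        using M by (auto simp: mat_kernel[where nr = n and nc = n]
            assoc_mult_mat_vec[where ?n\<^sub>1.0 = n and ?n\<^sub>2.0 = n and ?n\<^sub>3.0 = n])
    qed
    then have "dim_gen_eigenspace A e 2 = dim_gen_eigenspace A e 1"
      using M unfolding dim_gen_eigenspace_def kernel_dim_def by simp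
    \<comment> \<open>The kernel of the \<open>i\<close>-th power of \<open>?M\<close> has as
      dimension the sum of \<open>min i n\<close> over the sizes \<open>n\<close> of the blocks for
      \<open>e\<close>. Equal sums for \<open>i = 1\<close> and \<open>i = 2\<close>, compared term
      by term, leave no block larger than 1.\<close>
    then have eq: "(\<Sum>n\<leftarrow>map fst [(n, e')\<leftarrow>n_as . e' = e]. min 2 n) =
        (\<Sum>n\<leftarrow>map fst [(n, e')\<leftarrow>n_as . e' = e]. min 1 n)"
      unfolding dim_gen_eigenspace[OF jnf] .
    have sum_le: "(\<Sum>n\<leftarrow>ks. min 2 n) = (\<Sum>n\<leftarrow>ks. min 1 n) \<Longrightarrow> n \<in> set ks \<Longrightarrow> n \<le> 1"
      for ks :: "nat list" and n
    proof (induction ks)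
      case (Cons k ks)
      have "(\<Sum>n\<leftarrow>ks. min 1 n) \<le> (\<Sum>n\<leftarrow>ks. min (2::nat) n)"
        by (rule sum_list_mono) auto
      then show ?case using Cons by (auto simp: min_def split: if_splits)
    qed simp
    have "k \<in> set (map fst [(n, e')\<leftarrow>n_as . e' = e])" using ke by force
    from sum_le[OF eq this] have "k \<le> 1" .
    moreover have "k \<noteq> 0" using jnf ke unfolding jordan_nf_def by force
    ultimately show ?thesis by simp
  qed
  then have "diagonal_mat (jordan_matrix n_as)" by (rule diagonal_jordan_matrix)
  moreover have "similar_mat A (jordan_matrix n_as)" using jnf by (simp add: jordan_nf_def)
  ultimately show thesis by (rule that)
qed

section \<open>Tensor products\<close>

text \<open>Quotient and remainder by \<open>n\<close> decode a joint index of the tensor product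
  into its two local indices; the range is cut into \<open>m\<close> blocks of length
  \<open>n\<close>.\<close>

lemma split_sum:
  fixes f :: "nat \<Rightarrow> nat \<Rightarrow> 'a :: comm_monoid_add"
  shows "(\<Sum>k<m * n. f (k div n) (k mod n)) = (\<Sum>i<m. \<Sum>j<n. f i j)"
proof -
  have "(\<Sum>k<m * n. f (k div n) (k mod n)) = (\<Sum>i<m. \<Sum>k = i * n..<i * n + n. f (k div n) (k mod n))"
    by (rule sum.nat_group[symmetric])
  also have "\<dots> = (\<Sum>i<m. \<Sum>j<n. f i j)"
  proof (rule sum.cong)
    fix i
    have "(\<Sum>k = i * n..<i * n + n. f (k div n) (k mod n)) =
        (\<Sum>j = 0..<n. f ((j + i * n) div n) ((j + i * n) mod n))"
      using sum.shift_bounds_nat_ivl[of "\<lambda>k. f (k div n) (k mod n)" 0 "i * n" n]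
      by (simp add: add.commute)
    also have "\<dots> = (\<Sum>j<n. f i j)"
      by (auto simp: atLeast0LessThan intro!: sum.cong)
    finally show "(\<Sum>k = i * n..<i * n + n. f (k div n) (k mod n)) = (\<Sum>j<n. f i j)" .
  qed simp
  finally show ?thesis .
qed

lemma tensor_mat_dim [simp]:
  "dim_row (tensor_mat A B) = dim_row A * dim_row B"
  "dim_col (tensor_mat A B) = dim_col A * dim_col B"
  by (simp_all add: tensor_mat_def)

lemma tensor_mat_carrier [intro]:
  assumes "A \<in> carrier_mat m n" "B \<in> carrier_mat k l"
  shows "tensor_mat A B \<in> carrier_mat (m * k) (n * l)"
  using assms by (intro carrier_matI) auto

lemma div_mod_less_prod:
  fixes i :: nat
  assumes "i < m * n"
  shows "i div n < m" "i mod n < n"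
  using assms by (simp add: less_mult_imp_div_less, cases n, auto)

lemma tensor_mat_index:
  assumes "A \<in> carrier_mat m n" "B \<in> carrier_mat k l" "i < m * k" "j < n * l"
  shows "tensor_mat A B $$ (i, j) = A $$ (i div k, j div l) * B $$ (i mod k, j mod l)"
  using assms by (simp add: tensor_mat_def)

text \<open>The mixed product rule: after \<open>split_sum\<close>, the double sum factors into one
  entry of each local product.\<close>

lemma tensor_mat_mult:
  assumes A: "A \<in> carrier_mat m n" and B: "B \<in> carrier_mat k l"
    and C: "C \<in> carrier_mat n p" and E: "E \<in> carrier_mat l q"
  shows "tensor_mat A B * tensor_mat C E = tensor_mat (A * C) (B * E)"
proof (rule eq_matI)
  fix i j assume "i < dim_row (tensor_mat (A * C) (B * E))" "j < dim_col (tensor_mat (A * C) (B * E))"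
  then have i: "i < m * k" and j: "j < p * q" using assms by auto
  note ij = div_mod_less_prod[OF i] div_mod_less_prod[OF j]
  have "(tensor_mat A B * tensor_mat C E) $$ (i, j) =
      (\<Sum>r<n * l. tensor_mat A B $$ (i, r) * tensor_mat C E $$ (r, j))"
    using A B C E i j by (simp add: scalar_prod_def atLeast0LessThan)
  also have "\<dots> = (\<Sum>r<n * l. (A $$ (i div k, r div l) * B $$ (i mod k, r mod l)) *
      (C $$ (r div l, j div q) * E $$ (r mod l, j mod q)))"
    using i j by (intro sum.cong refl) (simp add: tensor_mat_index[OF A B] tensor_mat_index[OF C E])
  also have "\<dots> = (\<Sum>r<n. \<Sum>s<l. (A $$ (i div k, r) * B $$ (i mod k, s)) *
      (C $$ (r, j div q) * E $$ (s, j mod q)))"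
    by (rule split_sum)
  also have "\<dots> = (\<Sum>r<n. A $$ (i div k, r) * C $$ (r, j div q)) *
      (\<Sum>s<l. B $$ (i mod k, s) * E $$ (s, j mod q))"
    by (simp add: sum_product algebra_simps)
  also have "\<dots> = tensor_mat (A * C) (B * E) $$ (i, j)"
    using A B C E i j ij by (simp add: tensor_mat_index[where m = m and n = p and k = k and l = q]
        scalar_prod_def atLeast0LessThan)
  finally show "(tensor_mat A B * tensor_mat C E) $$ (i, j) = tensor_mat (A * C) (B * E) $$ (i, j)" .
qed (use assms in auto)

lemma tensor_mat_adjoint: "mat_adjoint (tensor_mat A B) = tensor_mat (mat_adjoint A) (mat_adjoint B)"
proof (rule eq_matI)
  fix i j assume "i < dim_row (tensor_mat (mat_adjoint A) (mat_adjoint B))"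
    "j < dim_col (tensor_mat (mat_adjoint A) (mat_adjoint B))"
  then have i: "i < dim_col A * dim_col B" and j: "j < dim_row A * dim_row B" by auto
  note ij = div_mod_less_prod[OF i] div_mod_less_prod[OF j]
  show "mat_adjoint (tensor_mat A B) $$ (i, j) = tensor_mat (mat_adjoint A) (mat_adjoint B) $$ (i, j)"
    using i j ij by (simp add: tensor_mat_def)
qed auto

lemma tensor_mat_one: "tensor_mat (1\<^sub>m m) (1\<^sub>m n) = 1\<^sub>m (m * n)"
proof (rule eq_matI)
  fix i j assume "i < dim_row (1\<^sub>m (m * n) :: complex mat)" "j < dim_col (1\<^sub>m (m * n) :: complex mat)"
  then have i: "i < m * n" and j: "j < m * n" by auto
  have "i = j \<longleftrightarrow> i div n = j div n \<and> i mod n = j mod n"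
    by (metis div_mult_mod_eq)
  then show "tensor_mat (1\<^sub>m m) (1\<^sub>m n) $$ (i, j) = 1\<^sub>m (m * n) $$ (i, j)"
    using i j div_mod_less_prod[OF i] div_mod_less_prod[OF j] by (auto simp: tensor_mat_def)
qed auto

lemma tensor_mat_zero:
  "tensor_mat (0\<^sub>m m n) B = 0\<^sub>m (m * dim_row B) (n * dim_col B)"
  "tensor_mat A (0\<^sub>m m n) = 0\<^sub>m (dim_row A * m) (dim_col A * n)"
  by (intro eq_matI; simp add: tensor_mat_def div_mod_less_prod)+

section \<open>Functional calculus and polar decomposition\<close>

text \<open>
  The functional calculus of \<open>A\<^sup>* A\<close>, obtained without unitarity: if \<open>A\<^sup>* A = P D P\<inverse>\<close> with \<open>D\<close>
  diagonal, then \<open>P\<^sup>* P\<close> commutes with \<open>D\<close>, hence with every function of \<open>D\<close>, and this makes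
  \<open>P f(D) P\<inverse>\<close> Hermitian.
\<close>

lemma functional_calculus:
  fixes A :: "complex mat"
  assumes A: "A \<in> carrier_mat n n"
  obtains F :: "(real \<Rightarrow> real) \<Rightarrow> complex mat"
  where "\<And>f. F f \<in> carrier_mat n n" "\<And>f. mat_adjoint (F f) = F f"
    and "\<And>f g. F f * F g = F (\<lambda>x. f x * g x)" "F (\<lambda>x. x) = mat_adjoint A * A"
    and "\<And>f g. (\<And>x. x \<ge> 0 \<Longrightarrow> f x = g x) \<Longrightarrow> F f = F g"
proof -
  let ?N = "mat_adjoint A * A"
  have N: "?N \<in> carrier_mat n n" by (rule mult_carrier_mat[OF adjoint_carrier[OF A] A])
  have "mat_adjoint ?N = ?N" using A by (simp add: adjoint_mult[where l = n and m = n and n = n])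
  from hermitian_diagonalizable[OF N this] obtain D P Q
    where diag: "diagonal_mat D" and wit: "similar_mat_wit ?N D P Q"
    unfolding similar_mat_def by blast
  note w = similar_mat_witD2[OF N wit]
  have [simp]: "D \<in> carrier_mat n n" "P \<in> carrier_mat n n" "Q \<in> carrier_mat n n"
    using w by auto
  \<comment> \<open>\<open>X\<close> and \<open>Y\<close> are the Gram matrices of the columns of
    \<open>P\<close> and of \<open>A * P\<close>. Both are Hermitian with squared norms on the
    diagonal, and \<open>Y = X * D\<close> carries this information over to
    \<open>D\<close>.\<close>
  define X where "X = mat_adjoint P * P"
  define Y where "Y = mat_adjoint (A * P) * (A * P)"
  have X [simp]: "X \<in> carrier_mat n n" by (auto simp: X_def)
  have AP: "A * P \<in> carrier_mat n n" using A by simp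
  have Y_eq: "Y = X * D"
  proof -
    have "Y = mat_adjoint P * mat_adjoint A * (A * P)"
      unfolding Y_def by (subst adjoint_mult[OF A, of _ n]) auto
    also have "\<dots> = mat_adjoint P * (?N * P)"
      using A by (simp add: assoc_mult_mat[where ?n\<^sub>1.0 = n and ?n\<^sub>2.0 = n and ?n\<^sub>3.0 = n and ?n\<^sub>4.0 = n])
    also have "?N * P = P * D * (Q * P)"
      unfolding w(3) by (rule assoc_mult_mat[of _ n n _ n _ n]) auto
    also have "\<dots> = P * D" unfolding w(2) by (rule right_mult_one_mat[of _ n n]) simp
    also have "mat_adjoint P * (P * D) = X * D"
      unfolding X_def by (rule assoc_mult_mat[of _ n n _ n _ n, symmetric]) auto
    finally show ?thesis .
  qed
  have XD: "Y $$ (i, j) = X $$ (i, j) * D $$ (j, j)" if "i < n" "j < n" for i j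
  proof -
    have "Y $$ (i, j) = (\<Sum>k<n. X $$ (i, k) * D $$ (k, j))"
      unfolding Y_eq using that carrier_matD[OF X] carrier_matD[OF w(5)]
      by (simp add: scalar_prod_def atLeast0LessThan)
    also have "\<dots> = (\<Sum>k<n. if k = j then X $$ (i, j) * D $$ (j, j) else 0)"
      using diag w that by (intro sum.cong) (auto simp: diagonal_mat_def)
    finally show ?thesis using that by simp
  qed
  have herm: "X $$ (j, i) = cnj (X $$ (i, j))" "Y $$ (j, i) = cnj (Y $$ (i, j))"
    if "i < n" "j < n" for i j
  proof -
    have "X = mat_adjoint X" "Y = mat_adjoint Y"
      unfolding X_def Y_def using AP
      by (simp_all add: adjoint_mult[where l = n and m = n and n = n])
    moreover have "Y \<in> carrier_mat n n" unfolding Y_eq using X by simp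
    ultimately show "X $$ (j, i) = cnj (X $$ (i, j))" "Y $$ (j, i) = cnj (Y $$ (i, j))"
      using that carrier_matD[OF X] adjoint_index[of j X i] adjoint_index[of j Y i] by auto
  qed
  have gram: "(mat_adjoint B * B) $$ (i, i) = col B i \<bullet>c col B i"
    if "B \<in> carrier_mat n n" "i < n" for B :: "complex mat" and i
    using that by (simp add: scalar_prod_def mult.commute)
  define d where "d i = Re (D $$ (i, i))" for i
  \<comment> \<open>By \<open>Y = X * D\<close> each eigenvalue is a quotient of two squared norms;
    the denominator is nonzero because the invertible \<open>P\<close> has no zero column.\<close>
  have d: "D $$ (i, i) = of_real (d i)" "d i \<ge> 0" if i: "i < n" for i
  proof -
    have "col P i \<noteq> 0\<^sub>v n"
    proof
      assume 0: "col P i = 0\<^sub>v n"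
      have "(Q * P) $$ (i, i) = row Q i \<bullet> col P i"
        using i carrier_matD[OF w(6)] carrier_matD[OF w(7)] by (intro index_mult_mat(1)) auto
      then show False using w i unfolding 0 by simp
    qed
    then have "Re (X $$ (i, i)) \<noteq> 0"
      unfolding X_def using i w by (subst gram) (auto simp: cscalar_prod_self_eq_0[where n = n])
    moreover have "X $$ (i, i) = of_real (Re (X $$ (i, i)))" "Re (X $$ (i, i)) \<ge> 0"
      unfolding X_def using i w by (simp_all only: gram cscalar_prod_self(1)[symmetric] cscalar_prod_self(2))
    moreover have "Y $$ (i, i) = of_real (Re (Y $$ (i, i)))" "Re (Y $$ (i, i)) \<ge> 0"
      unfolding Y_def using i AP by (simp_all only: gram cscalar_prod_self(1)[symmetric] cscalar_prod_self(2))
    moreover note XD[OF i i]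
    ultimately obtain x y where "x > 0" "y \<ge> 0" "of_real y = of_real x * D $$ (i, i)"
      by (metis order_le_less)
    then have "D $$ (i, i) = of_real (y / x)" by (simp add: field_simps)
    then show "D $$ (i, i) = of_real (d i)" "d i \<ge> 0"
      unfolding d_def using \<open>x > 0\<close> \<open>y \<ge> 0\<close> by auto
  qed
  define E where "E f = mat n n (\<lambda>(i, j). if i = j then complex_of_real (f (d i)) else 0)" for f
  have E [simp]: "E f \<in> carrier_mat n n" for f by (simp add: E_def)
  have E_mult: "E f * E g = E (\<lambda>x. f x * g x)" for f g
    by (rule eq_matI)
      (auto simp: E_def scalar_prod_def if_distrib[of "\<lambda>x. x * _"] if_distrib[of "\<lambda>x. _ * x"]
        cong: if_cong)
  have E_adj: "mat_adjoint (E f) = E f" for f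
    by (rule eq_matI) (auto simp: E_def)
  have comm: "X * E f = E f * X" for f
  proof (rule eq_matI)
    fix i j assume "i < dim_row (E f * X)" "j < dim_col (E f * X)"
    then have i: "i < n" and j: "j < n" using X E[of f] by auto
    \<comment> \<open>Comparing \<open>Y\<close> with its adjoint shows that \<open>X\<close> can be
      nonzero only where \<open>d i = d j\<close>, and there \<open>f\<close> takes equal values as
      well.\<close>
    have "X $$ (i, j) * of_real (d j) = of_real (d i) * X $$ (i, j)"
      using XD[OF i j] XD[OF j i] herm[OF i j] d i j
      by (metis complex_cnj_complex_of_real complex_cnj_mult complex_cnj_cnj mult.commute)
    then have "X $$ (i, j) = 0 \<or> d i = d j" by auto
    then have eq: "X $$ (i, j) * of_real (f (d j)) = of_real (f (d i)) * X $$ (i, j)" by auto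
    have "(X * E f) $$ (i, j) = X $$ (i, j) * of_real (f (d j))"
      using i j carrier_matD[OF X]
      by (simp add: E_def scalar_prod_def atLeast0LessThan if_distrib[of "\<lambda>x. _ * x"] cong: if_cong)
    moreover have "(E f * X) $$ (i, j) = of_real (f (d i)) * X $$ (i, j)"
      using i j carrier_matD[OF X]
      by (simp add: E_def scalar_prod_def atLeast0LessThan if_distrib[of "\<lambda>x. x * _"] cong: if_cong)
    ultimately show "(X * E f) $$ (i, j) = (E f * X) $$ (i, j)" using eq by simp
  qed (use carrier_matD[OF X] carrier_matD[OF E] in auto)
  note assoc = assoc_mult_mat[where ?n\<^sub>1.0 = n and ?n\<^sub>2.0 = n and ?n\<^sub>3.0 = n and ?n\<^sub>4.0 = n]
  define F where "F f = P * E f * Q" for f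
  show thesis
  proof
    fix f g :: "real \<Rightarrow> real"
    show "F f \<in> carrier_mat n n" by (simp add: F_def)
    have PQ: "P * Q = 1\<^sub>m n" and QP: "Q * P = 1\<^sub>m n" using w by auto
    have QP': "mat_adjoint Q * mat_adjoint P = 1\<^sub>m n"
      using adjoint_mult[of P n n Q n] PQ by simp
    \<comment> \<open>Inserting \<open>P * Q = 1\<close> puts \<open>X\<close> next to
      \<open>E f\<close>. After the two are commuted, the adjoints of \<open>Q\<close> and
      \<open>P\<close> stand side by side and cancel.\<close>
    have "mat_adjoint (F f) = mat_adjoint Q * (mat_adjoint (E f) * mat_adjoint P)"
      unfolding F_def
      using adjoint_mult[of "P * E f" n n Q n] adjoint_mult[of P n n "E f" n] by simp
    also have "\<dots> = mat_adjoint Q * (E f * (mat_adjoint P * (P * Q)))"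
      by (simp add: E_adj PQ right_mult_one_mat[of _ n n])
    also have "\<dots> = mat_adjoint Q * ((E f * X) * Q)"
      by (simp add: X_def assoc)
    also have "\<dots> = (mat_adjoint Q * mat_adjoint P) * (P * E f * Q)"
      unfolding comm[symmetric] by (simp add: X_def assoc)
    also have "\<dots> = F f" unfolding QP' F_def by (rule left_mult_one_mat[of _ n n]) simp
    finally show "mat_adjoint (F f) = F f" .
    have "F f * F g = P * (E f * ((Q * P) * (E g * Q)))"
      unfolding F_def by (simp add: assoc)
    also have "\<dots> = P * (E f * E g) * Q"
      unfolding QP by (simp add: left_mult_one_mat[of _ n n] assoc)
    finally show "F f * F g = F (\<lambda>x. f x * g x)" unfolding E_mult F_def .
    show "F f = F g" if "\<And>x. x \<ge> 0 \<Longrightarrow> f x = g x"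
    proof -
      \<comment> \<open>Only the values at the eigenvalues of \<open>mat_adjoint A * A\<close>
        enter, and these are nonnegative.\<close>
      have "E f = E g" unfolding E_def using d(2) that by (intro eq_matI) auto
      then show ?thesis by (simp add: F_def)
    qed
    have "E (\<lambda>x. x) = D"
      using diag carrier_matD[OF w(5)] d(1) by (intro eq_matI) (auto simp: E_def diagonal_mat_def)
    then show "F (\<lambda>x. x) = ?N" unfolding F_def using w(3) by simp
  qed
qed

lemma complement_idempotent:
  fixes T :: "complex mat"
  assumes T: "T \<in> carrier_mat n n" and TT: "T * T = T"
  shows "(1\<^sub>m n - T) * (1\<^sub>m n - T) = 1\<^sub>m n - T"
proof -
  have "(1\<^sub>m n - T) * (1\<^sub>m n - T) = (1\<^sub>m n - T) - (T - T * T)"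
    using T by (subst minus_mult_distrib_mat[of _ n n _ _ n])
      (auto simp: mult_minus_distrib_mat[of _ n n _ n])
  also have "\<dots> = 1\<^sub>m n - T" unfolding TT using T by (intro eq_matI) auto
  finally show ?thesis .
qed

text \<open>With \<bar>A\<bar> the positive square root of \<open>mat_adjoint A * A\<close>, the
  partial isometry \<open>U\<close> is \<open>A\<close> times the pseudo-inverse of \<bar>A\<bar>,
  so a singular \<open>A\<close> is covered, and \<open>U * mat_adjoint U\<close> projects onto the
  range of \<open>A\<close>. Writing \<bar>A\<bar> as \<open>G * G\<close> with Hermitian
  \<open>G\<close> records its positivity in a form that survives tensor products.\<close>

lemma polar_decomposition:
  fixes A :: "complex mat"
  assumes A: "A \<in> carrier_mat n n"
  obtains U G where "U \<in> carrier_mat n n" "G \<in> carrier_mat n n" "mat_adjoint G = G"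
    and "mat_adjoint U * A = G * G" "mat_adjoint A * A = (G * G) * (G * G)"
    and "(U * mat_adjoint U) * (U * mat_adjoint U) = U * mat_adjoint U"
    and "(1\<^sub>m n - U * mat_adjoint U) * A = 0\<^sub>m n n"
proof -
  from functional_calculus[OF A] obtain F :: "(real \<Rightarrow> real) \<Rightarrow> complex mat"
    where F [simp]: "\<And>f. F f \<in> carrier_mat n n" and F_adj: "\<And>f. mat_adjoint (F f) = F f"
      and F_mult: "\<And>f g. F f * F g = F (\<lambda>x. f x * g x)" and F_id: "F (\<lambda>x. x) = mat_adjoint A * A"
      and F_cong: "\<And>f g. (\<And>x. x \<ge> 0 \<Longrightarrow> f x = g x) \<Longrightarrow> F f = F g"
    by blast
  note assoc = assoc_mult_mat[where ?n\<^sub>1.0 = n and ?n\<^sub>2.0 = n and ?n\<^sub>3.0 = n and ?n\<^sub>4.0 = n]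
  \<comment> \<open>Since \<open>1 / 0 = 0\<close>, this is the square root of the pseudo-inverse of \<open>A\<^sup>* A\<close>.\<close>
  define I where "I = F (\<lambda>x. 1 / sqrt x)"
  define G where "G = F (\<lambda>x. sqrt (sqrt x))"
  define U where "U = A * I"
  define T where "T = U * mat_adjoint U"
  have [simp]: "A \<in> carrier_mat n n" "I \<in> carrier_mat n n" "U \<in> carrier_mat n n" "T \<in> carrier_mat n n"
    using A by (auto simp: I_def U_def T_def)
  have U_adj: "mat_adjoint U = I * mat_adjoint A"
    unfolding U_def by (subst adjoint_mult[OF A, of _ n]) (auto simp: I_def F_adj)
  have GG: "G * G = F sqrt"
    unfolding G_def F_mult by (rule F_cong) simp
  have IN: "I * (mat_adjoint A * A) = F sqrt"
    unfolding I_def F_id[symmetric] F_mult by (rule F_cong) (simp add: real_div_sqrt)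
  have UA: "mat_adjoint U * A = F sqrt"
    unfolding U_adj IN[symmetric] by (simp add: assoc)
  \<comment> \<open>The pseudo-inverse identity, valid at eigenvalue 0 too because
    \<open>1 / 0 = 0\<close>; it yields \<open>T * U = U\<close>.\<close>
  have III: "I * (F sqrt * I) = I"
    unfolding I_def F_mult by (rule F_cong) simp
  have adj_T: "mat_adjoint T = T"
    unfolding T_def by (subst adjoint_mult[of _ n n _ n]) auto
  have TU: "T * U = U"
  proof -
    have "T * U = U * (mat_adjoint U * U)"
      by (simp add: T_def assoc)
    also have "mat_adjoint U * U = (mat_adjoint U * A) * I"
      by (subst (2) U_def) (simp add: assoc)
    also have "U * \<dots> = A * (I * (F sqrt * I))"
      unfolding UA by (subst U_def) (simp add: assoc)
    also have "\<dots> = U" unfolding III U_def ..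
    finally show ?thesis .
  qed
  have TT: "T * T = T"
  proof -
    have "T * T = (T * U) * mat_adjoint U" by (subst (2) T_def) (simp add: assoc)
    then show ?thesis by (simp add: TU) (simp add: T_def)
  qed
  \<comment> \<open>\<open>R\<close> is the part of \<open>A\<close> outside the range of
    \<open>U\<close>. Its Gram matrix is \<open>mat_adjoint A * A\<close> minus the square of
    \<bar>A\<bar>, hence zero, so \<open>R\<close> vanishes.\<close>
  define R where "R = (1\<^sub>m n - T) * A"
  have [simp]: "1\<^sub>m n - T \<in> carrier_mat n n" by (rule minus_carrier_mat) simp
  have [simp]: "R \<in> carrier_mat n n" by (simp add: R_def)
  have "mat_adjoint R * R = 0\<^sub>m n n"
  proof -
    have adj: "mat_adjoint (1\<^sub>m n - T) = 1\<^sub>m n - T"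
      by (subst adjoint_minus[of _ n n]) (auto simp: adj_T)
    have idem: "(1\<^sub>m n - T) * (1\<^sub>m n - T) = 1\<^sub>m n - T"
      using TT by (intro complement_idempotent) simp_all
    have "mat_adjoint R = mat_adjoint A * (1\<^sub>m n - T)"
      unfolding R_def by (subst adjoint_mult[of _ n n _ n]) (auto simp: adj)
    then have "mat_adjoint R * R = mat_adjoint A * (((1\<^sub>m n - T) * (1\<^sub>m n - T)) * A)"
      by (simp add: R_def assoc)
    also have "\<dots> = mat_adjoint A * (A - T * A)"
      unfolding idem by (subst minus_mult_distrib_mat[of _ n n _ _ n]) (auto simp: left_mult_one_mat[OF A])
    also have "\<dots> = mat_adjoint A * A - mat_adjoint A * (T * A)"
      by (subst mult_minus_distrib_mat[of _ n n _ n]) auto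
    also have "mat_adjoint A * (T * A) = mat_adjoint (mat_adjoint U * A) * (mat_adjoint U * A)"
      using adjoint_mult[of "mat_adjoint U" n n A n] by (simp add: T_def assoc)
    also have "\<dots> = mat_adjoint A * A"
      unfolding UA F_adj F_mult F_id[symmetric] by (rule F_cong) simp
    finally show ?thesis by (metis minus_r_inv_mat mult_carrier_mat adjoint_carrier A)
  qed
  then have "R = 0\<^sub>m n n" by (rule adjoint_mult_self_eq_0[rotated]) simp
  moreover have "mat_adjoint A * A = (G * G) * (G * G)"
    unfolding GG F_mult F_id[symmetric] by (rule F_cong) simp
  moreover have "G \<in> carrier_mat n n" "mat_adjoint G = G"
    by (simp_all add: G_def F_adj)
  ultimately show thesis
    using that[of U G] UA GG TT unfolding R_def T_def by simp
qed

section \<open>LOCC protocols\<close>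

lemma pure_density_carrier [simp]: "\<phi> \<in> carrier_vec n \<Longrightarrow> pure_density \<phi> \<in> carrier_mat n n"
  by (simp add: pure_density_def)

lemma pure_density_zero: "pure_density (0\<^sub>v n) = 0\<^sub>m n n"
  by (intro eq_matI) (auto simp: pure_density_def)

lemma pure_density_conjugation:
  assumes K: "K \<in> carrier_mat m n" and \<phi>: "\<phi> \<in> carrier_vec n"
  shows "K * pure_density \<phi> * mat_adjoint K = pure_density (K *\<^sub>v \<phi>)"
proof (rule eq_matI)
  fix i j assume "i < dim_row (pure_density (K *\<^sub>v \<phi>))" "j < dim_col (pure_density (K *\<^sub>v \<phi>))"
  then have i: "i < m" and j: "j < m" using K by (auto simp: pure_density_def)
  have "(K * pure_density \<phi> * mat_adjoint K) $$ (i, j) =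
      (\<Sum>l<n. (\<Sum>k<n. K $$ (i, k) * (\<phi> $ k * cnj (\<phi> $ l))) * cnj (K $$ (j, l)))"
    using K \<phi> i j by (simp add: scalar_prod_def atLeast0LessThan pure_density_def)
  also have "\<dots> = (\<Sum>k<n. K $$ (i, k) * \<phi> $ k) * (\<Sum>l<n. cnj (K $$ (j, l) * \<phi> $ l))"
    by (simp add: sum_distrib_left sum_distrib_right mult_ac)
  also have "\<dots> = pure_density (K *\<^sub>v \<phi>) $$ (i, j)"
    using K \<phi> i j by (simp add: scalar_prod_def atLeast0LessThan pure_density_def)
  finally show "(K * pure_density \<phi> * mat_adjoint K) $$ (i, j) = pure_density (K *\<^sub>v \<phi>) $$ (i, j)" .
qed (use K in \<open>auto simp: pure_density_def\<close>)

lemma local_op_carrier [simp]: "K \<in> carrier_mat (D p) (D p) \<Longrightarrow> local_op D p K \<in> carrier_mat (joint_dim D) (joint_dim D)"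
  by (cases p) (auto intro: tensor_mat_carrier)

text \<open>\<open>K\<close> is the intended operation and \<open>R\<close> only completes the
  instrument. As \<open>R\<close> annihilates the state, just one term of the Kraus sum survives and
  the output stays pure.\<close>

lemma apply_kraus_pair:
  assumes K: "K \<in> carrier_mat (D p) (D p)" and R: "R \<in> carrier_mat (D p) (D p)"
    and \<phi>: "\<phi> \<in> carrier_vec (joint_dim D)"
    and 0: "local_op D p R *\<^sub>v \<phi> = 0\<^sub>v (joint_dim D)"
  shows "apply_kraus D p (D p) [K, R] (pure_density \<phi>) = pure_density (local_op D p K *\<^sub>v \<phi>)"
proof -
  have "pure_density (local_op D p K *\<^sub>v \<phi>) \<in> carrier_mat (joint_dim D) (joint_dim D)"
    by (rule pure_density_carrier[OF mult_mat_vec_carrier[OF local_op_carrier[where D = D and p = p, OF K] \<phi>]])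
  then show ?thesis
    unfolding apply_kraus_def sum_mats_def
    by (simp add: pure_density_conjugation[OF local_op_carrier[where D = D and p = p, OF K] \<phi>]
        pure_density_conjugation[OF local_op_carrier[where D = D and p = p, OF R] \<phi>] 0 pure_density_zero)
qed

text \<open>The first Kraus operator contributes the projection \<open>T = U * mat_adjoint U\<close>
  to the sum and the second contributes \<open>1 - T\<close>. Both sit in one branch, so a single
  continuation suffices.\<close>

lemma instrument_pair:
  assumes U: "U \<in> carrier_mat n n"
    and "(U * mat_adjoint U) * (U * mat_adjoint U) = U * mat_adjoint U"
  shows "instrument n [(n, [mat_adjoint U, 1\<^sub>m n - U * mat_adjoint U])]"
proof -
  define T where "T = U * mat_adjoint U"
  have T: "T \<in> carrier_mat n n" and TT: "T * T = T"
    using assms by (simp_all add: T_def)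
  have R: "1\<^sub>m n - T \<in> carrier_mat n n" using T by (rule minus_carrier_mat)
  have "mat_adjoint T = T"
    unfolding T_def using U by (simp add: adjoint_mult[of _ n n _ n])
  then have adj: "mat_adjoint (1\<^sub>m n - T) = 1\<^sub>m n - T"
    using T by (simp add: adjoint_minus[of _ n n])
  have "T + ((1\<^sub>m n - T) * (1\<^sub>m n - T) + 0\<^sub>m n n) = 1\<^sub>m n"
    unfolding complement_idempotent[OF T TT] using T by (intro eq_matI) auto
  then show ?thesis
    using U R unfolding instrument_def sum_mats_def T_def[symmetric]
    by (simp add: adj) (simp add: T_def)
qed

section \<open>Relabelling the answers of a protocol\<close>

lemma valid_map_locc: "valid_locc D Q \<Longrightarrow> valid_locc D (map_locc f Q)"
proof (induction D Q rule: valid_locc.induct)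
  case (2 D p bs)
  have eq: "map ((\<lambda>(d, Ks, Q). (d, Ks)) \<circ> map_prod id (map_prod id (map_locc f))) bs =
      map (\<lambda>(d, Ks, Q). (d, Ks)) bs"
    by auto
  have inst: "instrument (D p) (map (\<lambda>(d, Ks, Q). (d, Ks)) bs)"
    and sub: "\<And>d Ks Q. (d, Ks, Q) \<in> set bs \<Longrightarrow> valid_locc (D(p := d)) Q"
    using "2.prems" by auto
  have "valid_locc (D(p := d)) (map_locc f Q)" if "(d, Ks, Q) \<in> set bs" for d Ks Q
    using "2.IH"[OF that refl refl sub[OF that]] .
  then show ?case using inst by (auto simp: eq)
qed simp

text \<open>Injectivity is required at \<open>l\<close> only, so \<open>f\<close> may send all
  irrelevant answers to one default value.\<close>

lemma answer_prob_map_locc: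
  assumes "\<And>x. f x = f l \<Longrightarrow> x = l"
  shows "answer_prob D (map_locc f Q) \<rho> (f l) = answer_prob D Q \<rho> l"
  using assms
proof (induction D Q \<rho> l rule: answer_prob.induct)
  case (2 D p bs \<rho> l)
  have "answer_prob (D(p := d)) (map_locc f Q) (apply_kraus D p d Ks \<rho>) (f l) =
      answer_prob (D(p := d)) Q (apply_kraus D p d Ks \<rho>) l" if "(d, Ks, Q) \<in> set bs" for d Ks Q
    using "2.IH"[OF that refl refl] "2.prems" by blast
  then show ?case by (auto intro!: arg_cong[of _ _ sum_list] map_cong)
qed auto

section \<open>States remaining after projective measurements\<close>

text \<open>\<open>M\<close> is any joint operator instead of one local projector, so that
  successive measurements can be described by their product acting on the original set.\<close>

definition normalized_images :: "nat \<Rightarrow> complex mat \<Rightarrow> complex vec set \<Rightarrow> complex vec set" where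
  "normalized_images n M S = {normalized (M *\<^sub>v \<psi>) | \<psi>. \<psi> \<in> S \<and> M *\<^sub>v \<psi> \<noteq> 0\<^sub>v n}"

lemma post_states_eq: "post_states D p P S = normalized_images (joint_dim D) (local_op D p P) S"
  by (simp add: post_states_def normalized_images_def)

lemma normalized_smult:
  assumes "c > 0"
  shows "normalized (complex_of_real c \<cdot>\<^sub>v \<psi>) = normalized \<psi>"
proof -
  have "Re ((complex_of_real c \<cdot>\<^sub>v \<psi>) \<bullet>c (complex_of_real c \<cdot>\<^sub>v \<psi>)) = c\<^sup>2 * Re (\<psi> \<bullet>c \<psi>)"
    by (simp add: cscalar_prod_smult_left[where n = "dim_vec \<psi>"]
        cscalar_prod_smult_right[where n = "dim_vec \<psi>"] power2_eq_square)
  then show ?thesis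
    using assms by (simp add: normalized_def real_sqrt_mult smult_smult_assoc)
qed

lemma normalized_obtain:
  assumes "\<psi> \<in> carrier_vec n" "\<psi> \<noteq> 0\<^sub>v n"
  obtains c where "c > 0" "normalized \<psi> = complex_of_real c \<cdot>\<^sub>v \<psi>"
proof
  show "1 / sqrt (Re (\<psi> \<bullet>c \<psi>)) > 0"
    using assms cscalar_prod_self(2)[of \<psi>] cscalar_prod_self_eq_0[of \<psi> n] by simp
qed (simp add: normalized_def)

lemma smult_vec_eq_0_iff:
  assumes "\<psi> \<in> carrier_vec n" "c \<noteq> 0"
  shows "complex_of_real c \<cdot>\<^sub>v \<psi> = 0\<^sub>v n \<longleftrightarrow> \<psi> = 0\<^sub>v n"
  using assms by (auto simp: vec_eq_iff)

lemma mult_mat_vec_normalized: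
  assumes L: "L \<in> carrier_mat n n" and \<psi>: "\<psi> \<in> carrier_vec n" "\<psi> \<noteq> 0\<^sub>v n"
  obtains c where "c > 0" "L *\<^sub>v normalized \<psi> = complex_of_real c \<cdot>\<^sub>v (L *\<^sub>v \<psi>)"
  using normalized_obtain[OF \<psi>] mult_mat_vec[OF L \<psi>(1)] by metis

text \<open>Normalizing in between only inserts a positive factor, which the final normalization
  removes; a state annihilated by \<open>M\<close> is annihilated by \<open>L * M\<close> as
  well.\<close>

lemma normalized_images_mult:
  assumes L: "L \<in> carrier_mat n n" and M: "M \<in> carrier_mat n n" and S: "S \<subseteq> carrier_vec n"
  shows "normalized_images n L (normalized_images n M S) = normalized_images n (L * M) S"
proof -
  have step: "normalized (L *\<^sub>v normalized (M *\<^sub>v \<psi>)) = normalized ((L * M) *\<^sub>v \<psi>)"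
      "L *\<^sub>v normalized (M *\<^sub>v \<psi>) = 0\<^sub>v n \<longleftrightarrow> (L * M) *\<^sub>v \<psi> = 0\<^sub>v n"
    if "\<psi> \<in> S" "M *\<^sub>v \<psi> \<noteq> 0\<^sub>v n" for \<psi>
  proof -
    have \<psi>: "\<psi> \<in> carrier_vec n" using that S by auto
    have "M *\<^sub>v \<psi> \<in> carrier_vec n" using M \<psi> by simp
    from mult_mat_vec_normalized[OF L this that(2)] obtain c where c: "c > 0"
      "L *\<^sub>v normalized (M *\<^sub>v \<psi>) = complex_of_real c \<cdot>\<^sub>v (L *\<^sub>v (M *\<^sub>v \<psi>))" .
    then show "normalized (L *\<^sub>v normalized (M *\<^sub>v \<psi>)) = normalized ((L * M) *\<^sub>v \<psi>)"
      "L *\<^sub>v normalized (M *\<^sub>v \<psi>) = 0\<^sub>v n \<longleftrightarrow> (L * M) *\<^sub>v \<psi> = 0\<^sub>v n"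
      using L M \<psi> by (simp_all add: normalized_smult smult_vec_eq_0_iff assoc_mult_mat_vec[OF L M])
  qed
  have "M *\<^sub>v \<psi> \<noteq> 0\<^sub>v n" if "\<psi> \<in> S" "(L * M) *\<^sub>v \<psi> \<noteq> 0\<^sub>v n" for \<psi>
  proof
    assume "M *\<^sub>v \<psi> = 0\<^sub>v n"
    then have "(L * M) *\<^sub>v \<psi> = L *\<^sub>v 0\<^sub>v n"
      using assoc_mult_mat_vec[OF L M] that S by auto
    then show False using that(2) mult_mat_zero_vec[OF L] by simp
  qed
  with step show ?thesis
    unfolding normalized_images_def by (smt (verit, best) Collect_cong mem_Collect_eq)
qed

definition orthogonal_images :: "complex mat \<Rightarrow> complex vec set \<Rightarrow> bool" where
  "orthogonal_images M S \<longleftrightarrow>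
     (\<forall>\<psi>\<in>S. \<forall>\<phi>\<in>S. \<psi> \<noteq> \<phi> \<longrightarrow> (M *\<^sub>v \<psi>) \<bullet>c (M *\<^sub>v \<phi>) = 0)"

text \<open>The hypothesis on \<open>L\<close> speaks of distinct members of the set of normalized
  images. It applies because nonzero images under \<open>M\<close> of distinct states are
  orthogonal, hence distinct after normalization.\<close>

lemma orthogonal_images_mult:
  assumes L: "L \<in> carrier_mat n n" and M: "M \<in> carrier_mat n n" and S: "S \<subseteq> carrier_vec n"
    and orth: "orthogonal_images M S" "orthogonal_images L (normalized_images n M S)"
  shows "orthogonal_images (L * M) S"
  unfolding orthogonal_images_def
proof (intro ballI impI)
  fix \<psi> \<phi> assume in_S: "\<psi> \<in> S" "\<phi> \<in> S" and neq: "\<psi> \<noteq> \<phi>"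
  then have \<psi>: "\<psi> \<in> carrier_vec n" and \<phi>: "\<phi> \<in> carrier_vec n" using S by auto
  have car: "M *\<^sub>v \<psi> \<in> carrier_vec n" "M *\<^sub>v \<phi> \<in> carrier_vec n"
    "L *\<^sub>v (M *\<^sub>v \<psi>) \<in> carrier_vec n" "L *\<^sub>v (M *\<^sub>v \<phi>) \<in> carrier_vec n"
    using L M \<psi> \<phi> by auto
  have LM: "(L * M) *\<^sub>v \<psi> = L *\<^sub>v (M *\<^sub>v \<psi>)" "(L * M) *\<^sub>v \<phi> = L *\<^sub>v (M *\<^sub>v \<phi>)"
    using assoc_mult_mat_vec[OF L M] \<psi> \<phi> by auto
  have zero: "L *\<^sub>v 0\<^sub>v n = 0\<^sub>v n" by (rule mult_mat_zero_vec[OF L])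
  show "((L * M) *\<^sub>v \<psi>) \<bullet>c ((L * M) *\<^sub>v \<phi>) = 0"
  proof (cases "M *\<^sub>v \<psi> = 0\<^sub>v n \<or> M *\<^sub>v \<phi> = 0\<^sub>v n")
    case True
    then show ?thesis unfolding LM using car zero by (auto simp: cscalar_prod_eq_sum[where n = n])
  next
    case False
    let ?\<psi> = "normalized (M *\<^sub>v \<psi>)" and ?\<phi> = "normalized (M *\<^sub>v \<phi>)"
    obtain a b where ab: "a > 0" "b > 0"
      "?\<psi> = complex_of_real a \<cdot>\<^sub>v (M *\<^sub>v \<psi>)" "?\<phi> = complex_of_real b \<cdot>\<^sub>v (M *\<^sub>v \<phi>)"
      using normalized_obtain[OF car(1)] normalized_obtain[OF car(2)] False by metis
    have "?\<psi> \<noteq> ?\<phi>"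
    proof
      assume "?\<psi> = ?\<phi>"
      have "(M *\<^sub>v \<psi>) \<bullet>c (M *\<^sub>v \<phi>) = 0"
        using orth(1) in_S neq by (simp add: orthogonal_images_def)
      then have "?\<psi> \<bullet>c ?\<phi> = 0"
        unfolding ab(3,4) using car
        by (simp add: cscalar_prod_smult_left[where n = n] cscalar_prod_smult_right[where n = n])
      moreover have "?\<psi> \<in> carrier_vec n" unfolding ab(3) using car by simp
      ultimately have "?\<psi> = 0\<^sub>v n"
        using \<open>?\<psi> = ?\<phi>\<close> conjugate_square_eq_0_vec[of ?\<psi> n] by simp
      then show False using False ab(1,3) car by (simp add: smult_vec_eq_0_iff)
    qed
    moreover have "?\<psi> \<in> normalized_images n M S" "?\<phi> \<in> normalized_images n M S"
      using in_S False by (auto simp: normalized_images_def)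
    ultimately have "(L *\<^sub>v ?\<psi>) \<bullet>c (L *\<^sub>v ?\<phi>) = 0"
      using orth(2) by (simp add: orthogonal_images_def)
    then show ?thesis
      unfolding LM ab(3,4) mult_mat_vec[OF L car(1)] mult_mat_vec[OF L car(2)] using car ab(1,2)
      by (simp add: cscalar_prod_smult_left[where n = n] cscalar_prod_smult_right[where n = n])
  qed
qed

lemma local_op_tensor_mat:
  assumes P: "P \<in> carrier_mat (D p) (D p)"
    and A: "A \<in> carrier_mat (D Alice) (D Alice)" and B: "B \<in> carrier_mat (D Bob) (D Bob)"
  obtains A' B' where "A' \<in> carrier_mat (D Alice) (D Alice)" "B' \<in> carrier_mat (D Bob) (D Bob)"
    "local_op D p P * tensor_mat A B = tensor_mat A' B'"
proof (cases p)
  case Alice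
  then have "local_op D p P * tensor_mat A B = tensor_mat (P * A) (1\<^sub>m (D Bob) * B)"
    using tensor_mat_mult[OF P[unfolded Alice] one_carrier_mat A B] by simp
  then show thesis using that[of "P * A" B] assms Alice by simp
next
  case Bob
  then have "local_op D p P * tensor_mat A B = tensor_mat (1\<^sub>m (D Alice) * A) (P * B)"
    using tensor_mat_mult[OF one_carrier_mat P[unfolded Bob] A B] by simp
  then show thesis using that[of A "P * B"] assms Bob by simp
qed

text \<open>The invariant along a sequence of outcomes: \<open>S\<close> is the original set,
  \<open>S'\<close> the current one, and \<open>A\<close>, \<open>B\<close> collect the projectors
  applied so far. They are generalized in the induction since each step multiplies one of them by a
  projector.\<close>

lemma remaining_normalized_images:
  assumes "remaining D S' Q ks S''" "op_lpcc D S' Q" "S \<subseteq> carrier_vec (joint_dim D)"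
    and "A \<in> carrier_mat (D Alice) (D Alice)" "B \<in> carrier_mat (D Bob) (D Bob)"
    and "S' = normalized_images (joint_dim D) (tensor_mat A B) S"
    and "orthogonal_images (tensor_mat A B) S"
  shows "\<exists>A' B'. A' \<in> carrier_mat (D Alice) (D Alice) \<and> B' \<in> carrier_mat (D Bob) (D Bob) \<and>
    S'' = normalized_images (joint_dim D) (tensor_mat A' B') S \<and>
    orthogonal_images (tensor_mat A' B') S"
  using assms
proof (induction arbitrary: A B)
  case (1 S' Q)
  then show ?case by blast
next
  case (2 k bs P Q p S' ks S'')
  let ?d = "joint_dim D" and ?L = "local_op D p P" and ?M = "tensor_mat A B"
  have "(P, Q) \<in> set bs" using 2(1,2) by (metis nth_mem)
  then have op: "OPLPM D S' p (map fst bs)" "P \<in> set (map fst bs)"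
    "op_lpcc D (post_states D p P S') Q"
    using "2.prems"(1) by force+
  then have P: "P \<in> carrier_mat (D p) (D p)"
    by (auto simp: OPLPM_def projective_measurement_def projector_def)
  have L: "?L \<in> carrier_mat ?d ?d" by (rule local_op_carrier) (rule P)
  have M: "?M \<in> carrier_mat ?d ?d" using "2.prems"(3,4) by auto
  obtain A' B' where A': "A' \<in> carrier_mat (D Alice) (D Alice)"
    and B': "B' \<in> carrier_mat (D Bob) (D Bob)" and eq: "?L * ?M = tensor_mat A' B'"
    using local_op_tensor_mat[OF P "2.prems"(3,4)] by blast
  have "orthogonal_images ?L S'"
    using op(1,2) by (auto simp: OPLPM_def orthogonal_images_def)
  then have "orthogonal_images (?L * ?M) S"
    using orthogonal_images_mult[OF L M "2.prems"(2,6)] "2.prems"(5) by simp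
  moreover have "post_states D p P S' = normalized_images ?d (?L * ?M) S"
    unfolding post_states_eq "2.prems"(5) by (rule normalized_images_mult[OF L M "2.prems"(2)])
  ultimately show ?case
    using "2.IH"[OF op(3) "2.prems"(2) A' B'] unfolding eq by blast
qed

section \<open>Recovering the basis states\<close>

text \<open>Expanding one of the two copies of \<open>x\<close> over the spanning set gives
  \<open>x \<bullet>c x = 0\<close>.\<close>

lemma orthogonal_to_spanning_set:
  assumes S: "S \<subseteq> carrier_vec n" and span: "LinearCombinations.module.span class_ring (module_vec TYPE(complex) n) S = carrier_vec n"
    and x: "x \<in> carrier_vec n" and orth: "\<And>s. s \<in> S \<Longrightarrow> x \<bullet>c s = 0"
  shows "x = 0\<^sub>v n"
proof -
  interpret vec_space "TYPE(complex)" n .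
  have "x \<in> span S" unfolding span by (rule x)
  then obtain a T where T: "finite T" "T \<subseteq> S" and lc: "x = lincomb a T"
    unfolding span_def by blast
  have T_car: "T \<subseteq> carrier_vec n" using T S by auto
  have "x \<bullet>c x = (\<Sum>i<n. x $ i * cnj (\<Sum>t\<in>T. a t * t $ i))"
    using x by (subst cscalar_prod_eq_sum[where n = n])
      (auto simp: lc lincomb_index[OF _ T_car] intro!: sum.cong)
  also have "\<dots> = (\<Sum>t\<in>T. cnj (a t) * (\<Sum>i<n. x $ i * cnj (t $ i)))"
    by (simp add: sum_distrib_left algebra_simps, rule sum.swap)
  also have "\<dots> = (\<Sum>t\<in>T. cnj (a t) * (x \<bullet>c t))"
    using T_car by (intro sum.cong) (auto simp: cscalar_prod_eq_sum[where n = n])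
  also have "\<dots> = 0" using orth T by (intro sum.neutral) auto
  finally show ?thesis using x by simp
qed

text \<open>Uniqueness of the positive square root, for one eigenvector. With
  \<open>H = G * G\<close>, the vector \<open>x = (H - s) \<psi>\<close> satisfies
  \<open>H x = - s x\<close>, which positivity of \<open>H\<close> excludes for \<open>s > 0\<close>
  unless \<open>x\<close> is zero. For \<open>s = 0\<close>, the squared norm of
  \<open>H \<psi>\<close> is the inner product of \<open>\<psi>\<close> with
  \<open>H H \<psi> = 0\<close>.\<close>

lemma square_eigenvector:
  fixes G :: "complex mat"
  assumes G: "G \<in> carrier_mat n n" and herm: "mat_adjoint G = G" and \<psi>: "\<psi> \<in> carrier_vec n"
    and s: "s \<ge> 0" and eig: "(G * G) * (G * G) *\<^sub>v \<psi> = complex_of_real (s\<^sup>2) \<cdot>\<^sub>v \<psi>"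
  shows "(G * G) *\<^sub>v \<psi> = complex_of_real s \<cdot>\<^sub>v \<psi>"
proof -
  define H where "H = G * G"
  have H: "H \<in> carrier_mat n n" using G by (simp add: H_def)
  have adj: "mat_adjoint H = H" using adjoint_mult[OF G G] herm by (simp add: H_def)
  have pos: "(H *\<^sub>v x) \<bullet>c x = (G *\<^sub>v x) \<bullet>c (G *\<^sub>v x)" if x: "x \<in> carrier_vec n" for x
    using cscalar_prod_adjoint[OF G _ x, of "G *\<^sub>v x"] G x
    by (simp add: H_def herm assoc_mult_mat_vec[OF G G])
  define x where "x = H *\<^sub>v \<psi> - complex_of_real s \<cdot>\<^sub>v \<psi>"
  have H\<psi>: "H *\<^sub>v \<psi> \<in> carrier_vec n" using H \<psi> by simp
  have x: "x \<in> carrier_vec n" using H\<psi> \<psi> by (simp add: x_def)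
  have "H *\<^sub>v x = H *\<^sub>v (H *\<^sub>v \<psi>) - complex_of_real s \<cdot>\<^sub>v (H *\<^sub>v \<psi>)"
    unfolding x_def using H \<psi> H\<psi> by (simp add: mult_minus_distrib_mat_vec[OF H] mult_mat_vec[OF H])
  also have "H *\<^sub>v (H *\<^sub>v \<psi>) = complex_of_real (s\<^sup>2) \<cdot>\<^sub>v \<psi>"
    using eig assoc_mult_mat_vec[OF H H \<psi>] by (simp add: H_def)
  finally have Hx: "H *\<^sub>v x = - complex_of_real s \<cdot>\<^sub>v x"
    unfolding x_def using H\<psi> \<psi> H by (intro eq_vecI) (auto simp: power2_eq_square algebra_simps)
  have "(H *\<^sub>v x) \<bullet>c x = - complex_of_real s * (x \<bullet>c x)"
    unfolding Hx using x by (rule cscalar_prod_smult_left[OF x])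
  then have sum: "Re ((G *\<^sub>v x) \<bullet>c (G *\<^sub>v x)) + s * Re (x \<bullet>c x) = 0"
    unfolding pos[OF x] by simp
  show ?thesis
  proof (cases "s = 0")
    case True
    have "(H *\<^sub>v \<psi>) \<bullet>c (H *\<^sub>v \<psi>) = \<psi> \<bullet>c (H *\<^sub>v (H *\<^sub>v \<psi>))"
      using cscalar_prod_adjoint[OF H \<psi> H\<psi>] adj by simp
    also have "H *\<^sub>v (H *\<^sub>v \<psi>) = complex_of_real (s\<^sup>2) \<cdot>\<^sub>v \<psi>"
      using eig assoc_mult_mat_vec[OF H H \<psi>] by (simp add: H_def)
    also have "\<dots> = 0\<^sub>v n" using True \<psi> by (intro eq_vecI) auto
    finally have "H *\<^sub>v \<psi> = 0\<^sub>v n"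
      using H\<psi> \<psi> by simp
    also have "0\<^sub>v n = complex_of_real s \<cdot>\<^sub>v \<psi>" using True \<psi> by (intro eq_vecI) auto
    finally show ?thesis by (simp add: H_def)
  next
    case False
    then have "Re (x \<bullet>c x) = 0"
      using sum s cscalar_prod_self(2)[of x] cscalar_prod_self(2)[of "G *\<^sub>v x"]
      by (metis add_nonneg_eq_0_iff mult_eq_0_iff mult_nonneg_nonneg)
    then have "x = 0\<^sub>v n" using x by (simp add: cscalar_prod_self_eq_0)
    then show ?thesis
      unfolding x_def H_def[symmetric] by (rule minus_vec_eq_0D[OF H\<psi>, rotated]) (simp add: \<psi>)
  qed
qed

text \<open>The difference of the two sides is orthogonal to every \<open>\<phi>\<close> in
  \<open>S\<close>: for \<open>\<phi> \<noteq> \<psi>\<close> by orthogonality of the states and of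
  their images, for \<open>\<phi> = \<psi>\<close> by the choice of the eigenvalue.\<close>

lemma orthogonal_images_eigenvector:
  assumes S: "S \<subseteq> carrier_vec n"
    and span: "LinearCombinations.module.span class_ring (module_vec TYPE(complex) n) S = carrier_vec n"
    and ortho: "\<forall>\<psi>\<in>S. \<forall>\<phi>\<in>S. \<psi> \<bullet>c \<phi> = (if \<psi> = \<phi> then 1 else 0)"
    and M: "M \<in> carrier_mat n n" and orth: "orthogonal_images M S" and \<psi>: "\<psi> \<in> S"
  shows "(mat_adjoint M * M) *\<^sub>v \<psi> = ((M *\<^sub>v \<psi>) \<bullet>c (M *\<^sub>v \<psi>)) \<cdot>\<^sub>v \<psi>"
proof (rule minus_vec_eq_0D)
  have \<psi>_car: "\<psi> \<in> carrier_vec n" using \<psi> S by auto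
  have M\<psi>: "M *\<^sub>v \<psi> \<in> carrier_vec n" using M \<psi>_car by simp
  have N: "mat_adjoint M * M \<in> carrier_mat n n" using M by simp
  show car: "(mat_adjoint M * M) *\<^sub>v \<psi> \<in> carrier_vec n" by (rule mult_mat_vec_carrier[OF N \<psi>_car])
  show car': "((M *\<^sub>v \<psi>) \<bullet>c (M *\<^sub>v \<psi>)) \<cdot>\<^sub>v \<psi> \<in> carrier_vec n" using \<psi>_car by simp
  show "(mat_adjoint M * M) *\<^sub>v \<psi> - ((M *\<^sub>v \<psi>) \<bullet>c (M *\<^sub>v \<psi>)) \<cdot>\<^sub>v \<psi> = 0\<^sub>v n"
  proof (rule orthogonal_to_spanning_set[OF S span])
    fix \<phi> assume \<phi>: "\<phi> \<in> S"
    then have \<phi>_car: "\<phi> \<in> carrier_vec n" using S by auto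
    have "((mat_adjoint M * M) *\<^sub>v \<psi>) \<bullet>c \<phi> = (M *\<^sub>v \<psi>) \<bullet>c (M *\<^sub>v \<phi>)"
      using cscalar_prod_adjoint[OF adjoint_carrier[OF M] M\<psi> \<phi>_car]
      by (simp add: assoc_mult_mat_vec[OF adjoint_carrier[OF M] M \<psi>_car])
    then show "((mat_adjoint M * M) *\<^sub>v \<psi> - ((M *\<^sub>v \<psi>) \<bullet>c (M *\<^sub>v \<psi>)) \<cdot>\<^sub>v \<psi>) \<bullet>c \<phi> = 0"
      using ortho orth \<psi> \<phi>
      by (auto simp: cscalar_prod_minus_left[OF car car' \<phi>_car]
          cscalar_prod_smult_left[OF \<psi>_car \<phi>_car] orthogonal_images_def)
  qed (use car car' in simp)
qed

text \<open>Meant for the complementary Kraus operators, which must annihilate every remaining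
  state.\<close>

lemma mult_normalized_eq_0:
  assumes X: "X \<in> carrier_mat n n" and M: "M \<in> carrier_mat n n" and \<psi>: "\<psi> \<in> carrier_vec n"
    and nz: "M *\<^sub>v \<psi> \<noteq> 0\<^sub>v n" and 0: "X * M = 0\<^sub>m n n"
  shows "X *\<^sub>v normalized (M *\<^sub>v \<psi>) = 0\<^sub>v n"
proof -
  have M\<psi>: "M *\<^sub>v \<psi> \<in> carrier_vec n" using M \<psi> by simp
  have "X *\<^sub>v (M *\<^sub>v \<psi>) = 0\<^sub>m n n *\<^sub>v \<psi>"
    using assoc_mult_mat_vec[OF X M \<psi>] unfolding 0 ..
  also have "\<dots> = 0\<^sub>v n" using \<psi> by (intro eq_vecI) auto
  finally have "X *\<^sub>v (M *\<^sub>v \<psi>) = 0\<^sub>v n" .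
  with mult_mat_vec_normalized[OF X M\<psi> nz] obtain c
    where "X *\<^sub>v normalized (M *\<^sub>v \<psi>) = complex_of_real c \<cdot>\<^sub>v 0\<^sub>v n" by metis
  also have "\<dots> = 0\<^sub>v n" by (intro eq_vecI) auto
  finally show ?thesis .
qed

text \<open>Alice applies \<open>mat_adjoint U\<close> and Bob \<open>mat_adjoint V\<close>, which
  together turn each image back into its preimage in \<open>S\<close>. Then the protocol for
  \<open>S\<close> runs, with its answers translated to the images.\<close>

lemma locc_distinguishable_normalized_images:
  fixes D :: "party \<Rightarrow> nat"
  defines "d \<equiv> joint_dim D"
  assumes S: "S \<subseteq> carrier_vec d"
    and span: "LinearCombinations.module.span class_ring (module_vec TYPE(complex) d) S = carrier_vec d"
    and ortho: "\<forall>\<psi>\<in>S. \<forall>\<phi>\<in>S. \<psi> \<bullet>c \<phi> = (if \<psi> = \<phi> then 1 else 0)"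
    and dist: "locc_distinguishable D S"
    and A: "A \<in> carrier_mat (D Alice) (D Alice)" and B: "B \<in> carrier_mat (D Bob) (D Bob)"
    and orth: "orthogonal_images (tensor_mat A B) S"
  shows "locc_distinguishable D (normalized_images d (tensor_mat A B) S)"
proof -
  obtain Q where Q: "valid_locc D Q" "\<And>\<psi>. \<psi> \<in> S \<Longrightarrow> answer_prob D Q (pure_density \<psi>) \<psi> = 1"
    using dist unfolding locc_distinguishable_def by blast
  let ?m = "D Alice" and ?n = "D Bob"
  obtain U G where U: "U \<in> carrier_mat ?m ?m" and G: "G \<in> carrier_mat ?m ?m" "mat_adjoint G = G"
    and UA: "mat_adjoint U * A = G * G" and AA: "mat_adjoint A * A = (G * G) * (G * G)"
    and UU: "(U * mat_adjoint U) * (U * mat_adjoint U) = U * mat_adjoint U"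
    and U0: "(1\<^sub>m ?m - U * mat_adjoint U) * A = 0\<^sub>m ?m ?m"
    by (rule polar_decomposition[OF A])
  obtain V H where V: "V \<in> carrier_mat ?n ?n" and H: "H \<in> carrier_mat ?n ?n" "mat_adjoint H = H"
    and VB: "mat_adjoint V * B = H * H" and BB: "mat_adjoint B * B = (H * H) * (H * H)"
    and VV: "(V * mat_adjoint V) * (V * mat_adjoint V) = V * mat_adjoint V"
    and V0: "(1\<^sub>m ?n - V * mat_adjoint V) * B = 0\<^sub>m ?n ?n"
    by (rule polar_decomposition[OF B])
  define R where "R = 1\<^sub>m ?m - U * mat_adjoint U"
  define R' where "R' = 1\<^sub>m ?n - V * mat_adjoint V"
  have R: "R \<in> carrier_mat ?m ?m" unfolding R_def by (rule minus_carrier_mat) (simp add: U)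
  have R': "R' \<in> carrier_mat ?n ?n" unfolding R'_def by (rule minus_carrier_mat) (simp add: V)
  note U' = adjoint_carrier[OF U] and V' = adjoint_carrier[OF V]
  define M where "M = tensor_mat A B"
  \<comment> \<open>\<open>E * E\<close> is the tensor product of \<bar>A\<bar> and \<bar>B\<bar>,
    that is \<bar>M\<bar>; its Hermitian root \<open>E\<close> is named because
    \<open>square_eigenvector\<close> asks for one.\<close>
  define E where "E = tensor_mat G H"
  define W where "W = tensor_mat (mat_adjoint U) (mat_adjoint V)"
  have M: "M \<in> carrier_mat d d" unfolding M_def d_def using A B by (rule tensor_mat_carrier)
  have E: "E \<in> carrier_mat d d" unfolding E_def d_def using G(1) H(1) by (rule tensor_mat_carrier)
  have W: "W \<in> carrier_mat d d" unfolding W_def d_def using U' V' by (rule tensor_mat_carrier)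
  have E_adj: "mat_adjoint E = E" by (simp add: E_def tensor_mat_adjoint G H)
  have EE: "E * E = tensor_mat (G * G) (H * H)"
    unfolding E_def by (rule tensor_mat_mult) (use G H in auto)
  have WM: "W * M = E * E"
    unfolding W_def M_def EE tensor_mat_mult[OF U' V' A B] UA VB ..
  have "mat_adjoint M * M = tensor_mat ((G * G) * (G * G)) ((H * H) * (H * H))"
    unfolding M_def tensor_mat_adjoint tensor_mat_mult[OF adjoint_carrier[OF A] adjoint_carrier[OF B] A B] AA BB ..
  also have "\<dots> = (E * E) * (E * E)"
    unfolding EE by (rule tensor_mat_mult[symmetric]) (use G H in auto)
  finally have MM: "mat_adjoint M * M = (E * E) * (E * E)" .

  have recover: "W *\<^sub>v normalized (M *\<^sub>v \<psi>) = \<psi>" if \<psi>: "\<psi> \<in> S" and nz: "M *\<^sub>v \<psi> \<noteq> 0\<^sub>v d" for \<psi>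
  proof -
    have \<psi>_car: "\<psi> \<in> carrier_vec d" using \<psi> S by auto
    have M\<psi>: "M *\<^sub>v \<psi> \<in> carrier_vec d" using M \<psi>_car by simp
    \<comment> \<open>\<open>s\<close> is both the eigenvalue of \<open>E * E\<close> at
      \<open>\<psi>\<close> and the norm by which \<open>normalized\<close> divides, so the two
      cancel.\<close>
    define s where "s = sqrt (Re ((M *\<^sub>v \<psi>) \<bullet>c (M *\<^sub>v \<psi>)))"
    have s: "s > 0"
      using nz cscalar_prod_self(2)[of "M *\<^sub>v \<psi>"] cscalar_prod_self_eq_0[OF M\<psi>] by (simp add: s_def)
    have "(M *\<^sub>v \<psi>) \<bullet>c (M *\<^sub>v \<psi>) = complex_of_real (s\<^sup>2)"
      using cscalar_prod_self[of "M *\<^sub>v \<psi>"] by (simp add: s_def)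
    then have "(E * E) * (E * E) *\<^sub>v \<psi> = complex_of_real (s\<^sup>2) \<cdot>\<^sub>v \<psi>"
      using orthogonal_images_eigenvector[OF S span ortho M _ \<psi>] orth MM by (simp add: M_def)
    then have "(E * E) *\<^sub>v \<psi> = complex_of_real s \<cdot>\<^sub>v \<psi>"
      using s by (intro square_eigenvector[OF E E_adj \<psi>_car]) auto
    then have "W *\<^sub>v (M *\<^sub>v \<psi>) = complex_of_real s \<cdot>\<^sub>v \<psi>"
      using assoc_mult_mat_vec[OF W M \<psi>_car] by (simp add: WM)
    then have "W *\<^sub>v normalized (M *\<^sub>v \<psi>) = complex_of_real (1 / s) \<cdot>\<^sub>v (complex_of_real s \<cdot>\<^sub>v \<psi>)"
      unfolding normalized_def s_def[symmetric] using mult_mat_vec[OF W M\<psi>] by simp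
    also have "\<dots> = \<psi>" using s by (simp add: smult_smult_assoc flip: of_real_mult)
    finally show ?thesis .
  qed

  \<comment> \<open>The default value has dimension \<open>d + 1\<close> and so is no post-measurement state.\<close>
  define f where "f \<psi> = (if \<psi> \<in> S \<and> M *\<^sub>v \<psi> \<noteq> 0\<^sub>v d then normalized (M *\<^sub>v \<psi>) else 0\<^sub>v (d + 1))" for \<psi>
  have norm_car: "normalized (M *\<^sub>v \<psi>) \<in> carrier_vec d" if "\<psi> \<in> S" for \<psi>
    unfolding normalized_def
    by (rule smult_carrier_vec[THEN iffD2, OF mult_mat_vec_carrier[OF M subsetD[OF S that]]])
  \<comment> \<open>The dimension rules out the default value for \<open>f \<phi>\<close>; then
    \<open>W\<close> recovers both \<open>\<phi>\<close> and \<open>\<psi>\<close> from the same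
    vector.\<close>
  have f_inj: "\<phi> = \<psi>" if \<psi>: "\<psi> \<in> S" "M *\<^sub>v \<psi> \<noteq> 0\<^sub>v d" and eq: "f \<phi> = f \<psi>" for \<phi> \<psi>
  proof -
    have "f \<psi> = normalized (M *\<^sub>v \<psi>)" using \<psi> by (simp add: f_def)
    moreover from this have "dim_vec (f \<phi>) = d" using norm_car[OF \<psi>(1)] eq by simp
    then have \<phi>: "\<phi> \<in> S" "M *\<^sub>v \<phi> \<noteq> 0\<^sub>v d" by (auto simp: f_def split: if_splits)
    ultimately have "normalized (M *\<^sub>v \<phi>) = normalized (M *\<^sub>v \<psi>)" using eq by (simp add: f_def)
    then show ?thesis using recover[OF \<phi>] recover[OF \<psi>] by metis
  qed

  define P where "P = Round Alice [(?m, [mat_adjoint U, R],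
    Round Bob [(?n, [mat_adjoint V, R'], map_locc f Q)])]"
  have "valid_locc D P"
    using instrument_pair[OF U UU, folded R_def] instrument_pair[OF V VV, folded R'_def]
      valid_map_locc[OF Q(1), of f]
    by (simp add: P_def)
  moreover have "answer_prob D P (pure_density \<chi>) \<chi> = 1" if "\<chi> \<in> normalized_images d M S" for \<chi>
  proof -
    from that obtain \<psi> where \<chi>: "\<chi> = normalized (M *\<^sub>v \<psi>)" and \<psi>: "\<psi> \<in> S" "M *\<^sub>v \<psi> \<noteq> 0\<^sub>v d"
      unfolding normalized_images_def by blast
    have \<psi>_car: "\<psi> \<in> carrier_vec d" by (rule subsetD[OF S \<psi>(1)])
    have \<chi>_car: "\<chi> \<in> carrier_vec d" unfolding \<chi> by (rule norm_car[OF \<psi>(1)])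
    have f\<psi>: "f \<psi> = \<chi>" using \<psi> by (simp add: f_def \<chi>)
    have 1: "local_op D Alice (mat_adjoint U) \<in> carrier_mat d d" "local_op D Alice R \<in> carrier_mat d d"
      "local_op D Bob (mat_adjoint V) \<in> carrier_mat d d" "local_op D Bob R' \<in> carrier_mat d d"
      unfolding d_def
      using local_op_carrier[where D = D and p = Alice, OF U'] local_op_carrier[where D = D and p = Alice, OF R]
        local_op_carrier[where D = D and p = Bob, OF V'] local_op_carrier[where D = D and p = Bob, OF R']
      by blast+
    define \<chi>' where "\<chi>' = local_op D Alice (mat_adjoint U) *\<^sub>v \<chi>"
    have \<chi>'_car: "\<chi>' \<in> carrier_vec d" unfolding \<chi>'_def by (rule mult_mat_vec_carrier[OF 1(1) \<chi>_car])
    \<comment> \<open>As \<open>R * A = 0\<close>, Alice's complementary operator annihilates the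
      whole range of \<open>M\<close>.\<close>
    have "local_op D Alice R * M = tensor_mat (R * A) (1\<^sub>m ?n * B)"
      unfolding M_def using tensor_mat_mult[OF R one_carrier_mat A B] by simp
    also have "\<dots> = 0\<^sub>m d d"
      using B U0 by (simp add: R_def tensor_mat_zero d_def)
    finally have "local_op D Alice R *\<^sub>v \<chi> = 0\<^sub>v d"
      unfolding \<chi> by (rule mult_normalized_eq_0[OF 1(2) M \<psi>_car \<psi>(2)])
    then have step1: "apply_kraus D Alice ?m [mat_adjoint U, R] (pure_density \<chi>) = pure_density \<chi>'"
      unfolding \<chi>'_def using apply_kraus_pair[where D = D and p = Alice, OF U' R] \<chi>_car unfolding d_def by blast
    \<comment> \<open>Bob acts on a state that Alice has already changed. Merging both operators
      into one tensor product acting on \<open>\<chi>\<close> lets \<open>R' * B = 0\<close> and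
      \<open>recover\<close> be applied to the original image.\<close>
    have prod: "local_op D Bob X * local_op D Alice (mat_adjoint U) = tensor_mat (mat_adjoint U) X"
      if X: "X \<in> carrier_mat ?n ?n" for X
      using tensor_mat_mult[OF one_carrier_mat X U' one_carrier_mat]
      by (simp add: left_mult_one_mat[OF U'] right_mult_one_mat[OF X])
    have "local_op D Bob R' *\<^sub>v \<chi>' = tensor_mat (mat_adjoint U) R' *\<^sub>v \<chi>"
      unfolding \<chi>'_def prod[OF R', symmetric] by (rule assoc_mult_mat_vec[OF 1(4) 1(1) \<chi>_car, symmetric])
    also have "\<dots> = 0\<^sub>v d"
      unfolding \<chi>
    proof (rule mult_normalized_eq_0[OF _ M \<psi>_car \<psi>(2)])
      show "tensor_mat (mat_adjoint U) R' \<in> carrier_mat d d"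
        unfolding d_def using U' R' by (rule tensor_mat_carrier)
      show "tensor_mat (mat_adjoint U) R' * M = 0\<^sub>m d d"
        unfolding M_def tensor_mat_mult[OF U' R' A B]
        using U A V0 by (simp add: R'_def tensor_mat_zero d_def)
    qed
    finally have "apply_kraus D Bob ?n [mat_adjoint V, R'] (pure_density \<chi>') =
        pure_density (local_op D Bob (mat_adjoint V) *\<^sub>v \<chi>')"
      using apply_kraus_pair[where D = D and p = Bob, OF V' R'] \<chi>'_car unfolding d_def by blast
    also have "local_op D Bob (mat_adjoint V) *\<^sub>v \<chi>' = W *\<^sub>v \<chi>"
      unfolding \<chi>'_def W_def prod[OF V', symmetric] by (rule assoc_mult_mat_vec[OF 1(3) 1(1) \<chi>_car, symmetric])
    also have "\<dots> = \<psi>" unfolding \<chi> by (rule recover[OF \<psi>])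
    finally have step2: "apply_kraus D Bob ?n [mat_adjoint V, R'] (pure_density \<chi>') = pure_density \<psi>" .
    have "answer_prob D P (pure_density \<chi>) \<chi> = answer_prob D (map_locc f Q) (pure_density \<psi>) (f \<psi>)"
      by (simp add: P_def step1 step2 f\<psi>)
    also have "\<dots> = answer_prob D Q (pure_density \<psi>) \<psi>"
      by (rule answer_prob_map_locc) (rule f_inj[OF \<psi>])
    finally show ?thesis using Q(2)[OF \<psi>(1)] by simp
  qed
  ultimately show ?thesis unfolding locc_distinguishable_def M_def by blast
qed

theorem theorem7:
  fixes D :: "party \<Rightarrow> nat" and S :: "complex vec set"
  assumes "complete_orthogonal_product_basis D S"
    and "locc_distinguishable D S"
  shows "\<not> activable_lpcc D S"
proof
  let ?d = "joint_dim D" and ?I = "tensor_mat (1\<^sub>m (D Alice)) (1\<^sub>m (D Bob))"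
  interpret vec_space "TYPE(complex)" ?d .
  have S: "S \<subseteq> carrier_vec ?d" and span: "span S = carrier_vec ?d"
    and ortho: "\<forall>\<psi>\<in>S. \<forall>\<phi>\<in>S. \<psi> \<bullet>c \<phi> = (if \<psi> = \<phi> then 1 else 0)"
    using assms(1) unfolding complete_orthogonal_product_basis_def basis_def by auto
  have I: "?I *\<^sub>v \<psi> = \<psi>" if "\<psi> \<in> S" for \<psi>
    using that S by (auto simp: tensor_mat_one)
  \<comment> \<open>The start of the induction over outcomes: before any measurement,
    \<open>A\<close> and \<open>B\<close> are identities, and normalizing does not change unit
    vectors.\<close>
  have images: "normalized_images ?d ?I S = S"
  proof -
    have "normalized \<psi> = \<psi>" "\<psi> \<noteq> 0\<^sub>v ?d" if "\<psi> \<in> S" for \<psi>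
    proof -
      have "\<psi> \<bullet>c \<psi> = 1" using ortho that by simp
      then show "normalized \<psi> = \<psi>" "\<psi> \<noteq> 0\<^sub>v ?d" by (auto simp: normalized_def)
    qed
    with I show ?thesis unfolding normalized_images_def by force
  qed
  have orth: "orthogonal_images ?I S" using ortho by (auto simp: orthogonal_images_def I)
  assume "activable_lpcc D S"
  then obtain Q ks S' where "op_lpcc D S Q" "remaining D S Q ks S'" and not: "\<not> locc_distinguishable D S'"
    unfolding activable_lpcc_def by blast
  then obtain A B where "A \<in> carrier_mat (D Alice) (D Alice)" "B \<in> carrier_mat (D Bob) (D Bob)"
    "S' = normalized_images ?d (tensor_mat A B) S" "orthogonal_images (tensor_mat A B) S"
    using remaining_normalized_images[OF _ _ S one_carrier_mat one_carrier_mat images[symmetric] orth]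
    by blast
  then have "locc_distinguishable D S'"
    using locc_distinguishable_normalized_images[OF S span ortho assms(2)] by simp
  with not show False by contradiction
qed

end
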